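(* Let $W$ be a 1-planar graph of class $\mathcal C_1$. Then $|E(W)|\le 3.6\,|V(W)|-7.2$. Moreover, this bound is tight: there exists a 1-planar graph $W$ of class $\mathcal C_1$ with $|E(W)|= 3.6\,|V(W)|-7.2$.
   Context: All graphs are finite, simple and undirected. A drawing of a graph in the plane is 1-planar if each edge is crossed at most once; a graph is 1-planar if it has a 1-planar drawing. In 1-planar drawings it is assumed that adjacent edges never cross and no edge crosses itself, so each crossing involves two edges with four distinct endvertices. For a 1-planar drawing $D$, the associated plane graph $D^\times$ is obtained by turning each crossing into a new vertex of degree four, called a false vertex; for a false vertex $c$, $N_{D^\times}(c)$ denotes its set of (four) neighbours in $D^\times$. A 1-planar graph is of class $\mathcal C_0$ if it has a 1-planar drawing $D$ such that $|N_{D^\times}(c_1)\cap N_{D^\times}(c_2)|=0$ for any two distinct false vertices $c_1,c_2$. For $i\in\{1,2\}$, a 1-planar graph is of class $\mathcal C_i$ if it is not of class $\mathcal C_k$ for any $k<i$ and it has a 1-planar drawing $D$ with $|N_{D^\times}(c_1)\cap N_{D^\times}(c_2)|\le i$ for any two distinct false vertices $c_1,c_2$. *)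

theory Defs
  imports "HOL-Analysis.Analysis"
begin

definition simple_graph :: "'a set \<Rightarrow> 'a set set \<Rightarrow> bool" where
  "simple_graph V E \<longleftrightarrow> finite V \<and> (\<forall>e\<in>E. e \<subseteq> V \<and> card e = 2)"

definition curve_interior :: "(real \<Rightarrow> real^2) \<Rightarrow> (real^2) set" where
  "curve_interior g = g ` {0<..<1}"

definition cross_points :: "('a set \<Rightarrow> real \<Rightarrow> real^2) \<Rightarrow> 'a set \<Rightarrow> 'a set \<Rightarrow> (real^2) set" where
  "cross_points \<gamma> e f = curve_interior (\<gamma> e) \<inter> curve_interior (\<gamma> f)"

definition one_planar_drawing ::
  "'a set \<Rightarrow> 'a set set \<Rightarrow> ('a \<Rightarrow> real^2) \<Rightarrow> ('a set \<Rightarrow> real \<Rightarrow> real^2) \<Rightarrow> bool" where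
  "one_planar_drawing V E pos \<gamma> \<longleftrightarrow>
     inj_on pos V \<and>
     (\<forall>e\<in>E. arc (\<gamma> e) \<and>
        (\<exists>u v. e = {u, v} \<and> pathstart (\<gamma> e) = pos u \<and> pathfinish (\<gamma> e) = pos v) \<and>
        curve_interior (\<gamma> e) \<inter> pos ` V = {}) \<and>
     (\<forall>e\<in>E. \<forall>f\<in>E. e \<noteq> f \<and> e \<inter> f \<noteq> {} \<longrightarrow> cross_points \<gamma> e f = {}) \<and>
     (\<forall>e\<in>E. (\<exists>p. (\<Union>f\<in>E - {e}. cross_points \<gamma> e f) \<subseteq> {p}) \<and>
             (\<exists>g. {f \<in> E - {e}. cross_points \<gamma> e f \<noteq> {}} \<subseteq> {g}))"

text \<open>Crossings (false vertices), each identified by the pair of edges crossing there;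
  its neighbourhood in the planarization is the union of the two edges.\<close>
definition crossings :: "'a set set \<Rightarrow> ('a set \<Rightarrow> real \<Rightarrow> real^2) \<Rightarrow> 'a set set set" where
  "crossings E \<gamma> = {{e, f} | e f. e \<in> E \<and> f \<in> E \<and> e \<noteq> f \<and> cross_points \<gamma> e f \<noteq> {}}"

definition false_nbhd :: "'a set set \<Rightarrow> 'a set" where
  "false_nbhd X = \<Union>X"

definition has_drawing_with_overlap :: "'a set \<Rightarrow> 'a set set \<Rightarrow> nat \<Rightarrow> bool" where
  "has_drawing_with_overlap V E i \<longleftrightarrow>
     (\<exists>pos \<gamma>. one_planar_drawing V E pos \<gamma> \<and>
        (\<forall>X\<in>crossings E \<gamma>. \<forall>Y\<in>crossings E \<gamma>. X \<noteq> Y \<longrightarrow>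
            card (false_nbhd X \<inter> false_nbhd Y) \<le> i))"

definition one_planar :: "'a set \<Rightarrow> 'a set set \<Rightarrow> bool" where
  "one_planar V E \<longleftrightarrow> simple_graph V E \<and> (\<exists>pos \<gamma>. one_planar_drawing V E pos \<gamma>)"

definition class_C1 :: "'a set \<Rightarrow> 'a set set \<Rightarrow> bool" where
  "class_C1 V E \<longleftrightarrow> one_planar V E \<and>
     has_drawing_with_overlap V E 1 \<and> \<not> has_drawing_with_overlap V E 0"

end

(*
  Let n, m and c be the numbers of vertices, edges and crossings of the drawing.  Deleting one edge
  from each crossing leaves a simple plane graph, so m - c <= 3n - 6.  On the other hand, if two
  false vertices never share two neighbours, then joining each crossing point to its four
  neighbours along the crossing edges gives a plane bipartite graph of girth at least 6 with n + c
  vertices and 4c edges, so 5c <= 3n - 6.  Together, m <= 3n - 6 + (3n - 6)/5.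

  Both plane bounds are instances of: a plane graph with a cycle, v vertices, e arcs and girth at
  least g satisfies g(e - v + 2) <= 2e.  The number of faces is at least e - v + 2, since an arc
  closing a cycle separates the two sides of a Jordan curve, and each arc borders at most two faces
  while the arcs bordering a face contain a cycle, by Janiszewski's theorem.

  The bound is attained by the cuboctahedron with both diagonals in each quadrangular face (n = 12,
  m = 36).  It is not of class C_0: disjoint neighbourhoods would allow at most 3 crossings, hence
  at most 30 + 3 edges.
*)

theory Submission
  imports Defs
begin

section \<open>Plane graphs\<close>

text \<open>Faces are handled as components of an open set in \<open>complex\<close>, without
  boundary walks or rotation systems, because the graphs in question may be disconnected and may
  have bridges. Hence a face is just a sample point. Euler's formula is replaced by a lower bound on
  the number of such points, and "the boundary is a closed walk" by "the bordering arcs are not a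
  forest". The latter fails for acyclic graphs, which are treated apart; there the assumptions on
  small \<open>card V\<close> enter. Girth 6 arises as follows: the bipartite graph has no odd
  cycle, and a 4-cycle would be two crossings with two common neighbours. With n + c vertices and 4c
  arcs, 6(4c - (n + c) + 2) <= 8c is 5c <= 3n - 6. The constants are then 3 + 3/5 = 3.6 and 6 + 6/5
  = 7.2. Being outside class C_0 matters for the upper bound too: it forces a crossing and so at
  least four vertices, while for one or two vertices the inequality can fail. Equality needs c = (3n
  - 6)/5 crossings. The cuboctahedron has 12 vertices and exactly 6 quadrangles, any two of which
  share at most one vertex.\<close>

locale plane_graph =
  fixes V :: "complex set" and AA :: "complex set set"
  assumes finite_V: "finite V" and finite_AA: "finite AA"
    and arc_AA: "\<And>A. A \<in> AA \<Longrightarrow> \<exists>g. arc g \<and> path_image g = A \<and> A \<inter> V = {pathstart g, pathfinish g}"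
    and Int_AA: "\<And>A B. A \<in> AA \<Longrightarrow> B \<in> AA \<Longrightarrow> A \<noteq> B \<Longrightarrow> A \<inter> B \<subseteq> V"
begin

definition carrier :: "complex set set \<Rightarrow> complex set" where
  "carrier BB = V \<union> \<Union>BB"

text \<open>A path without repeated vertices: \<open>S\<close> collects its vertices and
  \<open>P\<close> its arcs. Sets replace lists because only the visited vertices, the union and the
  number of the arcs matter later.\<close>

inductive trail :: "complex set set \<Rightarrow> complex \<Rightarrow> complex set \<Rightarrow> complex set set \<Rightarrow> complex \<Rightarrow> bool"
  for BB where
  trail_Nil: "u \<in> V \<Longrightarrow> trail BB u {u} {} u"
| trail_Cons: "trail BB w S P x \<Longrightarrow> A \<in> BB \<Longrightarrow> A \<inter> V = {u, w} \<Longrightarrow> u \<notin> S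
    \<Longrightarrow> trail BB u (insert u S) (insert A P) x"

definition adj :: "complex set set \<Rightarrow> complex rel" where
  "adj BB = {(u, w). \<exists>A\<in>BB. A \<inter> V = {u, w}}"

text \<open>A cycle is witnessed by an arc that is not a bridge, so no cycle has to be
  named.\<close>

definition cyclic :: "complex set set \<Rightarrow> bool" where
  "cyclic BB \<longleftrightarrow> (\<exists>A\<in>BB. \<exists>u w. A \<inter> V = {u, w} \<and> u \<noteq> w \<and> (u, w) \<in> (adj (BB - {A}))\<^sup>*)"

lemma arc_ends:
  assumes "A \<in> AA" "A \<inter> V = {u, w}"
  obtains g where "arc g" "path_image g = A" "pathstart g = u" "pathfinish g = w"
proof -
  obtain g where g: "arc g" "path_image g = A" "A \<inter> V = {pathstart g, pathfinish g}"
    using arc_AA[OF assms(1)] by blast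
  then consider "pathstart g = u" "pathfinish g = w" | "pathstart g = w" "pathfinish g = u"
    using assms(2) by (metis doubleton_eq_iff)
  then show thesis
  proof cases
    case 1 then show ?thesis using g that by blast
  next
    case 2 then show ?thesis using g that[of "reversepath g"]
      by (simp add: arc_reversepath)
  qed
qed

lemma ends_exist:
  assumes "A \<in> AA"
  obtains u w where "A \<inter> V = {u, w}" "u \<noteq> w"
  using arc_AA[OF assms] arc_distinct_ends by metis

lemma ends_neq:
  assumes "A \<in> AA" "A \<inter> V = {u, w}" shows "u \<noteq> w"
  using arc_ends[OF assms] arc_distinct_ends by metis

lemma carrier_mono: "BB \<subseteq> CC \<Longrightarrow> carrier BB \<subseteq> carrier CC"
  unfolding carrier_def by auto

lemma carrier_insert: "carrier (insert A BB) = carrier BB \<union> A"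
  unfolding carrier_def by auto

lemma compact_arc: "A \<in> AA \<Longrightarrow> compact A"
  using arc_AA compact_arc_image by blast

lemma compact_carrier: "BB \<subseteq> AA \<Longrightarrow> compact (carrier BB)"
  unfolding carrier_def
  using finite_V finite_AA compact_arc by (meson compact_Un compact_Union finite_imp_compact finite_subset subset_eq)

lemma closed_carrier: "BB \<subseteq> AA \<Longrightarrow> closed (carrier BB)"
  using compact_carrier compact_imp_closed by blast

lemma open_Compl_carrier: "BB \<subseteq> AA \<Longrightarrow> open (- carrier BB)"
  using closed_carrier by blast

lemma Int_carrier:
  assumes "BB \<subseteq> AA" "A \<in> AA" "A \<notin> BB"
  shows "A \<inter> carrier BB = A \<inter> V"
  using Int_AA assms unfolding carrier_def by blast

lemma adj_mono: "BB \<subseteq> CC \<Longrightarrow> adj BB \<subseteq> adj CC"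
  unfolding adj_def by blast

lemma cyclic_mono: "cyclic BB \<Longrightarrow> BB \<subseteq> CC \<Longrightarrow> cyclic CC"
  unfolding cyclic_def
  by (meson Diff_mono adj_mono equalityE rtrancl_mono subsetD)

section \<open>Trails as arcs and closed curves\<close>

lemma trail_subset: "trail BB u S P x \<Longrightarrow> P \<subseteq> BB \<and> u \<in> S \<and> x \<in> S \<and> finite S \<and> S \<subseteq> V"
  by (induction rule: trail.induct) auto

lemma trail_carrier: "trail BB u S P x \<Longrightarrow> V \<inter> \<Union>P \<subseteq> S"
  by (induction rule: trail.induct) (auto dest: trail_subset)

lemma trail_sub: "trail BB u S P x \<Longrightarrow> v \<in> S \<Longrightarrow> \<exists>S' P'. trail BB v S' P' x"
proof (induction rule: trail.induct)
  case (trail_Cons w S P x A u)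
  then show ?case using trail.trail_Cons by blast
qed (auto intro: trail.intros)

lemma reach_trail:
  assumes "(u, w) \<in> (adj BB)\<^sup>*" "w \<in> V"
  shows "\<exists>S P. trail BB u S P w"
  using assms
proof (induction rule: converse_rtrancl_induct)
  case base then show ?case using trail_Nil by blast
next
  case (step y z)
  then obtain S P where *: "trail BB z S P w" by blast
  obtain A where A: "A \<in> BB" "A \<inter> V = {y, z}" using step unfolding adj_def by auto
  \<comment> \<open>If \<open>y\<close> was visited already, the trail is cut at \<open>y\<close>;
    otherwise \<open>A\<close> is prepended.\<close>
  show ?case using trail_sub[OF *] trail_Cons[OF * A] by blast
qed

lemma trail_loop: "trail BB u S P x \<Longrightarrow> u = x \<Longrightarrow> P = {}"
  by (induction rule: trail.induct) (auto dest: trail_subset)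

text \<open>No vertex is visited twice and distinct arcs meet only in vertices, so each new arc
  meets the remaining trail only in their common end.\<close>

lemma trail_arc:
  assumes "trail BB u S P x" "BB \<subseteq> AA" "u \<noteq> x"
  shows "\<exists>g. arc g \<and> path_image g = \<Union>P \<and> pathstart g = u \<and> pathfinish g = x"
  using assms
proof (induction rule: trail.induct)
  case (trail_Cons w S P x A u)
  obtain h where h: "arc h" "path_image h = A" "pathstart h = u" "pathfinish h = w"
    using arc_ends trail_Cons by (metis subsetD)
  \<comment> \<open>For \<open>w = x\<close> the remaining trail is a single vertex, which is not an
    arc; then \<open>A\<close> alone is the result.\<close>
  show ?case
  proof (cases "w = x")
    case True
    then have "P = {}" using trail_loop trail_Cons(1) by blast
    then show ?thesis using h True by auto
  next
    case False
    then obtain g where g: "arc g" "path_image g = \<Union>P" "pathstart g = w" "pathfinish g = x"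
      using trail_Cons by blast
    have "A \<notin> P" using trail_Cons trail_carrier by blast
    then have "A \<inter> \<Union>P \<subseteq> V"
      using Int_AA trail_Cons trail_subset by blast
    then have "A \<inter> \<Union>P \<subseteq> {w}"
      using trail_carrier[OF trail_Cons(1)] trail_Cons(3,4) by fast
    then have "arc (h +++ g)" using arc_join[OF h(1) g(1)] h g by auto
    moreover have "path_image (h +++ g) = A \<union> \<Union>P" by (simp add: path_image_join h g)
    ultimately show ?thesis using h g by (intro exI[of _ "h +++ g"]) auto
  qed
qed auto

text \<open>The last two conclusions prepare for Janiszewski's theorem, which asks for a connected
  intersection.\<close>

lemma trail_closed_curve:
  assumes "trail BB u S P w" "BB \<subseteq> AA" "A \<in> AA" "A \<notin> BB" "A \<inter> V = {u, w}" "u \<noteq> w"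
  shows "\<exists>c. simple_path c \<and> pathfinish c = pathstart c \<and> path_image c = A \<union> \<Union>P"
    and "connected (\<Union>P)" and "A \<inter> \<Union>P = {u, w}"
proof -
  obtain g where g: "arc g" "path_image g = \<Union>P" "pathstart g = u" "pathfinish g = w"
    using trail_arc assms by metis
  obtain h where h: "arc h" "path_image h = A" "pathstart h = w" "pathfinish h = u"
    using arc_ends[of A w u] assms by (metis insert_commute)
  have "A \<inter> \<Union>P \<subseteq> V"
    using Int_AA assms trail_subset[OF assms(1)] by blast
  then have sub: "A \<inter> \<Union>P \<subseteq> {u, w}" using assms by blast
  have "u \<in> \<Union>P" "w \<in> \<Union>P" using g pathstart_in_path_image pathfinish_in_path_image by metis+
  then show "A \<inter> \<Union>P = {u, w}" using sub assms(5) by blast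
  have "simple_path (h +++ g)"
    by (rule simple_path_join_loop) (use h g sub in auto)
  moreover have "path_image (h +++ g) = A \<union> \<Union>P" by (simp add: path_image_join h g)
  ultimately show "\<exists>c. simple_path c \<and> pathfinish c = pathstart c \<and> path_image c = A \<union> \<Union>P"
    using h g by (intro exI[of _ "h +++ g"]) auto
  show "connected (\<Union>P)" using g connected_arc_image by metis
qed

section \<open>Bridges and forests separate nothing\<close>

lemma connected_Compl_arc: "A \<in> AA \<Longrightarrow> connected (- A)"
  using arc_AA[of A] connected_arc_complement[where 'a = complex] by (metis DIM_complex order_refl)

text \<open>The graph splits at the bridge into two compact pieces, each meeting the rest in a single
  point, so Janiszewski's theorem applies twice.\<close>

lemma bridge:
  assumes BB: "BB \<subseteq> AA" and A: "A \<in> AA" "A \<notin> BB" "A \<inter> V = {u, w}"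
    and nr: "(u, w) \<notin> (adj BB)\<^sup>*"
    and cc: "connected_component (- carrier BB) x y" and x: "x \<notin> A" and y: "y \<notin> A"
  shows "connected_component (- carrier (insert A BB)) x y"
proof -
  \<comment> \<open>\<open>S1\<close> is to carry the component of \<open>u\<close>, and
    \<open>S2\<close> everything else.\<close>
  define V1 where "V1 = {v\<in>V. (u, v) \<in> (adj BB)\<^sup>*}"
  define B1 where "B1 = {B\<in>BB. B \<inter> V \<subseteq> V1}"
  define S1 where "S1 = V1 \<union> \<Union>B1"
  define S2 where "S2 = (V - V1) \<union> \<Union>(BB - B1)"
  have outside: "B \<inter> V \<inter> V1 = {}" if B: "B \<in> BB - B1" for B
  proof (rule ccontr)
    assume ne: "B \<inter> V \<inter> V1 \<noteq> {}"
    have "B \<in> AA" using B BB by auto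
    then obtain a b where ab: "B \<inter> V = {a, b}" by (rule ends_exist)
    then have "(a, b) \<in> adj BB" "(b, a) \<in> adj BB" using B unfolding adj_def by auto
    then have "a \<in> V1 \<longleftrightarrow> b \<in> V1" using ab unfolding V1_def
      by (metis (mono_tags, lifting) IntD2 insertCI mem_Collect_eq rtrancl_into_rtrancl)
    then have "B \<inter> V \<subseteq> V1" using ne ab by auto
    then show False using B unfolding B1_def by auto
  qed
  have fin: "finite BB" using BB finite_AA finite_subset by blast
  have compU: "compact (\<Union>CC)" if "CC \<subseteq> BB" for CC
    using that compact_arc BB fin by (meson compact_Union finite_subset subset_eq)
  have "finite V1" "B1 \<subseteq> BB" unfolding V1_def B1_def using finite_V by auto
  then have c1: "compact S1" unfolding S1_def
    using compU by (simp add: compact_Un finite_imp_compact)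
  have c2: "compact S2" unfolding S2_def
    using compU[of "BB - B1"] finite_V by (simp add: compact_Un finite_imp_compact)
  have un: "S1 \<union> S2 = carrier BB" unfolding S1_def S2_def carrier_def V1_def B1_def by auto
  have AV: "A \<inter> B \<subseteq> {u, w}" if "B \<in> BB" for B using Int_AA A BB that by blast
  have "u \<in> V1" "w \<notin> V1" "u \<in> A" "w \<in> A" "w \<in> V" using A nr unfolding V1_def by auto
  have "z = u" if "z \<in> S1" "z \<in> A" for z
  proof -
    have "z \<in> V1"
      using that(1) AV[of _] A(3) \<open>z \<in> A\<close> unfolding S1_def B1_def by fast
    then have "z \<in> {u, w}" using that(2) A(3) unfolding V1_def by blast
    then show ?thesis using \<open>z \<in> V1\<close> \<open>w \<notin> V1\<close> by blast
  qed
  moreover have "z = w" if "z \<in> S2" "z \<in> A" for z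
  proof -
    have "z \<in> {u, w}"
      using that AV A(3) unfolding S2_def by fast
    moreover have "u \<notin> S2"
      using outside \<open>u \<in> V1\<close> unfolding S2_def V1_def by fast
    ultimately show ?thesis using that(1) by blast
  qed
  moreover have "u \<in> S1" "w \<in> S2"
    using \<open>u \<in> V1\<close> \<open>w \<notin> V1\<close> \<open>w \<in> V\<close> unfolding S1_def S2_def by auto
  ultimately have SA: "S1 \<inter> A = {u}" "S2 \<inter> A = {w}"
    using \<open>u \<in> A\<close> \<open>w \<in> A\<close> by blast+
  have "S1 \<inter> S2 = {}"
  proof -
    have "B \<inter> C \<subseteq> V" if "B \<in> B1" "C \<in> BB - B1" for B C
      using Int_AA[of B C] that BB unfolding B1_def by blast
    then have BC: "B \<inter> C = {}" if "B \<in> B1" "C \<in> BB - B1" for B C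
      using that outside[OF that(2)] unfolding B1_def by blast
    have "V1 \<inter> C = {}" if "C \<in> BB - B1" for C
      using outside[OF that] unfolding V1_def by blast
    then have "V1 \<inter> S2 = {}" unfolding S2_def by blast
    moreover have "B \<inter> S2 = {}" if "B \<in> B1" for B
      using BC[OF that] that unfolding S2_def B1_def by fast
    ultimately show ?thesis unfolding S1_def by blast
  qed
  \<comment> \<open>\<open>A\<close> meets the whole carrier in the two points \<open>u\<close> and
    \<open>w\<close>, which is not connected. Attaching \<open>A\<close> to \<open>S1\<close> and
    only then adding \<open>S2\<close> makes both intersections singletons.\<close>
  with SA have i: "S1 \<inter> A = {u}" "S2 \<inter> (S1 \<union> A) = {w}" by auto
  have "connected_component (- A) x y"
    using connected_Compl_arc[OF A(1)] x y connected_iff_connected_component by (metis ComplI)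
  moreover have "connected_component (- S1) x y" "connected_component (- S2) x y"
    using cc un connected_component_of_subset by (metis Compl_subset_Compl_iff Un_upper1 Un_upper2)+
  ultimately have "connected_component (- (S1 \<union> A)) x y"
    using Janiszewski[OF c1 compact_imp_closed[OF compact_arc[OF A(1)]]] i by simp
  then have "connected_component (- (S2 \<union> (S1 \<union> A))) x y"
    using Janiszewski[OF c2, of "S1 \<union> A"] i c1 compact_arc[OF A(1)]
      \<open>connected_component (- S2) x y\<close> by (simp add: closed_Un compact_imp_closed)
  moreover have "S2 \<union> (S1 \<union> A) = carrier (insert A BB)" using un carrier_insert by auto
  ultimately show ?thesis by simp
qed

text \<open>In a forest built up arc by arc, each new arc is a bridge.\<close>

lemma connected_Compl_forest:
  assumes "BB \<subseteq> AA" "\<not> cyclic BB"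
  shows "connected (- carrier BB)"
proof -
  have "finite BB" using assms finite_AA finite_subset by blast
  then show ?thesis using assms
  proof (induction BB rule: finite_induct)
    case empty
    have "connected (- V)"
      using connected_open_delete_finite[of UNIV V] finite_V
      by (simp add: Compl_eq_Diff_UNIV connected_UNIV)
    then show ?case unfolding carrier_def by simp
  next
    case (insert A BB)
    have "A \<in> AA" using insert by auto
    then obtain u w where uw: "A \<inter> V = {u, w}" "u \<noteq> w" by (rule ends_exist)
    have "connected (- carrier BB)" using insert cyclic_mono by blast
    moreover have "(u, w) \<notin> (adj BB)\<^sup>*"
      using insert uw unfolding cyclic_def by (metis Diff_insert_absorb insertI1)
    ultimately show ?case
      using bridge[of BB A u w] insert uw
      unfolding connected_iff_connected_component carrier_insert by auto
  qed
qed

end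

section \<open>Faces\<close>

text \<open>An arc has empty interior: the inverse of its parametrization would otherwise embed an
  open set of the plane into the line.\<close>

lemma arc_avoiding_point:
  fixes g :: "real \<Rightarrow> complex"
  assumes "arc g" "open S" "S \<noteq> {}"
  shows "\<exists>z\<in>S. z \<notin> path_image g"
proof (rule ccontr)
  assume "\<not> ?thesis"
  then have sub: "S \<subseteq> path_image g" by auto
  obtain h where h: "homeomorphism {0..1} (path_image g) g h"
    using homeomorphism_arc[OF assms(1)] by blast
  have "continuous_on S h"
    using h sub homeomorphism_cont2 continuous_on_subset by blast
  moreover have "inj_on h S"
    using h sub by (metis homeomorphism_def inj_on_inverseI subsetD)
  ultimately have "DIM(complex) \<le> DIM(real)"
    using invariance_of_dimension assms by blast
  then show False by simp
qed

context plane_graph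
begin

text \<open>Faces are represented by points, one in each of finitely many distinct components of the
  complement.\<close>

definition separated :: "complex set set \<Rightarrow> complex set \<Rightarrow> bool" where
  "separated BB Z \<longleftrightarrow> finite Z \<and> Z \<subseteq> - carrier BB \<and>
     (\<forall>x\<in>Z. \<forall>y\<in>Z. x \<noteq> y \<longrightarrow> \<not> connected_component (- carrier BB) x y)"

lemma move_off_arc:
  assumes "BB \<subseteq> AA" "A \<in> AA" "z \<in> - carrier BB"
  shows "\<exists>y. y \<in> - carrier (insert A BB) \<and> connected_component (- carrier BB) z y"
proof -
  obtain g where g: "arc g" "path_image g = A" using arc_AA assms by blast
  have "open (connected_component_set (- carrier BB) z)"
    by (simp add: open_connected_component open_Compl_carrier assms)
  moreover have "z \<in> connected_component_set (- carrier BB) z" using assms by simp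
  ultimately obtain y where "connected_component (- carrier BB) z y" "y \<notin> A"
    using arc_avoiding_point[OF g(1)] g(2) by (metis empty_iff mem_Collect_eq)
  then show ?thesis unfolding carrier_insert
    using connected_component_in by fastforce
qed

text \<open>A new arc may run through sample points, so they are first shifted within their
  components. Enlarging the carrier never merges components, so they stay separated.\<close>

lemma move_separated:
  assumes BB: "BB \<subseteq> AA" and A: "A \<in> AA" and Z: "separated BB Z"
  shows "\<exists>f. (\<forall>z\<in>Z. f z \<in> - carrier (insert A BB) \<and> connected_component (- carrier BB) z (f z)) \<and>
    separated (insert A BB) (f ` Z) \<and> card (f ` Z) = card Z"
proof -
  have "\<forall>z\<in>Z. \<exists>y. y \<in> - carrier (insert A BB) \<and> connected_component (- carrier BB) z y"
    using move_off_arc[OF BB A] Z unfolding separated_def by blast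
  then obtain f where f: "\<And>z. z \<in> Z \<Longrightarrow> f z \<in> - carrier (insert A BB)"
      "\<And>z. z \<in> Z \<Longrightarrow> connected_component (- carrier BB) z (f z)"
    by metis
  have sep: "x = y" if "x \<in> Z" "y \<in> Z" "connected_component (- carrier BB) (f x) (f y)" for x y
    using that f(2) Z unfolding separated_def
    by (meson connected_component_sym connected_component_trans)
  have cc: "connected_component (- carrier BB) a b"
    if "connected_component (- carrier (insert A BB)) a b" for a b
    using that connected_component_of_subset carrier_mono by (metis Compl_subset_Compl_iff subset_insertI)
  have "inj_on f Z"
  proof (rule inj_onI)
    fix x y assume "x \<in> Z" "y \<in> Z" "f x = f y"
    moreover have "connected_component (- carrier BB) (f x) (f x)"
      using f(2)[OF \<open>x \<in> Z\<close>] connected_component_in by fastforce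
    ultimately show "x = y" using sep by metis
  qed
  then have "card (f ` Z) = card Z" by (rule card_image)
  moreover have "separated (insert A BB) (f ` Z)"
    using Z f(1) sep cc unfolding separated_def by blast
  ultimately show ?thesis using f by blast
qed

text \<open>A small disc around an inner point \<open>a\<close> of \<open>A\<close> lies in one face
  of \<open>BB\<close>, but it meets both sides of the Jordan curve formed by \<open>A\<close> and a
  trail; so the new arc splits that face.\<close>

lemma chord_separates:
  assumes BB: "BB \<subseteq> AA" and A: "A \<in> AA" "A \<notin> BB" "A \<inter> V = {u, w}"
    and r: "(u, w) \<in> (adj BB)\<^sup>*"
  shows "\<exists>p q a. a \<in> - carrier BB \<and> p \<in> - carrier (insert A BB) \<and> q \<in> - carrier (insert A BB)
    \<and> connected_component (- carrier BB) a p \<and> connected_component (- carrier BB) a q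
    \<and> \<not> connected_component (- carrier (insert A BB)) p q"
proof -
  have uw: "u \<noteq> w" using ends_neq A by blast
  obtain S P where P: "trail BB u S P w" using reach_trail[OF r] A by auto
  have PB: "P \<subseteq> BB" using trail_subset P by blast
  obtain c where c: "simple_path c" "pathfinish c = pathstart c" "path_image c = A \<union> \<Union>P"
    using trail_closed_curve(1)[OF P BB A uw] by blast
  \<comment> \<open>An arc is connected, so it has a point besides its two ends.\<close>
  have "A \<noteq> {u, w}"
  proof
    assume "A = {u, w}"
    obtain g where g: "arc g" "path_image g = A" using arc_AA[OF A(1)] by blast
    then have "connected {u, w}" using \<open>A = {u, w}\<close> connected_arc_image by metis
    then show False using uw connected_finite_iff_sing[of "{u, w}"] by auto
  qed
  then obtain a where a: "a \<in> A" "a \<notin> V" using A(3) by blast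
  have aB: "a \<in> - carrier BB" using Int_carrier[OF BB A(1,2)] a by blast
  then obtain e where e: "e > 0" "ball a e \<subseteq> - carrier BB"
    using open_Compl_carrier[OF BB] open_contains_ball by blast
  obtain I J where IJ: "I \<inter> J = {}" "open I" "open J" "I \<union> J = - path_image c"
      "frontier I = path_image c" "frontier J = path_image c"
    using Jordan_curve[OF c(1,2)] by metis
  \<comment> \<open>Both sides have the whole curve as frontier, hence both come arbitrarily close
    to \<open>a\<close>.\<close>
  have near: "\<exists>p\<in>K. p \<in> ball a e" if "frontier K = path_image c" for K
    using that a c(3) e(1) unfolding frontier_def
    by (metis DiffE UnI1 closure_approachable dist_commute mem_ball)
  obtain p q where p: "p \<in> I" "p \<in> ball a e" and q: "q \<in> J" "q \<in> ball a e"
    using near IJ by meson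
  have cc: "connected_component (- carrier BB) a x" if "x \<in> ball a e" for x
    using that e by (metis centre_in_ball connected_ball connected_component_def)
  have sub: "path_image c \<subseteq> carrier (insert A BB)"
    using c PB unfolding carrier_def by auto
  have "\<not> connected_component (- carrier (insert A BB)) p q"
  proof
    assume "connected_component (- carrier (insert A BB)) p q"
    then obtain T where T: "connected T" "T \<subseteq> - carrier (insert A BB)" "p \<in> T" "q \<in> T"
      unfolding connected_component_def by blast
    then have "T \<subseteq> I \<union> J" using sub IJ by blast
    then show False using connectedD[OF T(1) IJ(2,3)] IJ(1) p q T(3,4) by blast
  qed
  moreover have "p \<notin> A" "q \<notin> A" using p q IJ c(3) by auto
  then have "p \<in> - carrier (insert A BB)" "q \<in> - carrier (insert A BB)"
    using p q e(2) unfolding carrier_insert by auto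
  ultimately show ?thesis using cc p q aB by blast
qed

lemma separated_chord:
  assumes BB: "BB \<subseteq> AA" and A: "A \<in> AA" "A \<notin> BB" "A \<inter> V = {u, w}"
    and r: "(u, w) \<in> (adj BB)\<^sup>*" and Z: "separated BB Z"
  shows "\<exists>Z'. separated (insert A BB) Z' \<and> card Z < card Z'"
proof -
  obtain p q a where pq: "a \<in> - carrier BB" "p \<in> - carrier (insert A BB)" "q \<in> - carrier (insert A BB)"
    "connected_component (- carrier BB) a p" "connected_component (- carrier BB) a q"
    "\<not> connected_component (- carrier (insert A BB)) p q"
    using chord_separates[OF BB A r] by blast
  \<comment> \<open>At most one sample point lies in the face of \<open>a\<close>. It is dropped and
    replaced by \<open>p\<close> and \<open>q\<close>, a gain of at least one.\<close>
  define Y where "Y = {z\<in>Z. \<not> connected_component (- carrier BB) a z}"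
  have fin: "finite Z" using Z unfolding separated_def by simp
  have Y: "separated BB Y" "card Z \<le> Suc (card Y)"
  proof -
    show "separated BB Y" using Z unfolding separated_def Y_def by auto
    have "x = y" if "x \<in> Z - Y" "y \<in> Z - Y" for x y
      using that Z unfolding separated_def Y_def
      by (metis (mono_tags, lifting) DiffD1 DiffD2 connected_component_sym connected_component_trans mem_Collect_eq)
    then have "card (Z - Y) \<le> 1" by (simp add: card_le_Suc0_iff_eq fin)
    moreover have "card Z = card Y + card (Z - Y)"
      using card_Diff_subset[of Y Z] card_mono[of Z Y] fin unfolding Y_def by (simp add: finite_subset)
    ultimately show "card Z \<le> Suc (card Y)" by simp
  qed
  obtain f where f: "\<And>z. z \<in> Y \<Longrightarrow> connected_component (- carrier BB) z (f z)"
    and fY: "separated (insert A BB) (f ` Y)" "card (f ` Y) = card Y"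
    using move_separated[OF BB A(1) Y(1)] by blast
  have cc: "connected_component (- carrier BB) x y"
    if "connected_component (- carrier (insert A BB)) x y" for x y
    using that connected_component_of_subset carrier_mono by (metis Compl_subset_Compl_iff subset_insertI)
  have away: "\<not> connected_component (- carrier (insert A BB)) (f z) x"
    if "z \<in> Y" "x = p \<or> x = q" for z x
  proof
    assume "connected_component (- carrier (insert A BB)) (f z) x"
    then have "connected_component (- carrier BB) (f z) x" by (rule cc)
    then have "connected_component (- carrier BB) a z"
      using f[OF that(1)] that(2) pq(4,5) by (meson connected_component_sym connected_component_trans)
    then show False using that(1) unfolding Y_def by simp
  qed
  have refl: "connected_component (- carrier (insert A BB)) p p"
    "connected_component (- carrier (insert A BB)) q q" using pq by auto
  have notin: "p \<notin> f ` Y" "q \<notin> f ` Y" "p \<noteq> q"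
    using away refl pq(6) by (metis (no_types, lifting) imageE)+
  have "separated (insert A BB) (insert p (insert q (f ` Y)))"
    using fY(1) away pq(2,3,6) unfolding separated_def
    by (auto dest: connected_component_sym)
  moreover have "card (insert p (insert q (f ` Y))) = Suc (Suc (card Y))"
    using notin fY unfolding separated_def by simp
  ultimately show ?thesis using Y(2) by (metis le_imp_less_Suc)
qed

text \<open>The labelling \<open>r\<close> tracks the connected components of the graph.\<close>

lemma face_count:
  assumes "BB \<subseteq> AA"
  shows "\<exists>Z r. separated BB Z \<and> card BB + 1 + card (r ` V) \<le> card Z + card V \<and>
    (\<forall>x\<in>V. \<forall>y\<in>V. r x = (r y :: complex) \<longrightarrow> (x, y) \<in> (adj BB)\<^sup>*)"
proof -
  have "finite BB" using assms finite_AA finite_subset by blast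
  then show ?thesis using assms
  proof (induction BB rule: finite_induct)
    case empty
    obtain z where "z \<notin> V" using finite_V infinite_UNIV_char_0 ex_new_if_finite by blast
    then have "separated {} {z}" unfolding separated_def carrier_def by simp
    \<comment> \<open>Without arcs there is one face and each vertex is its own component; the
      inequality is an equality.\<close>
    then show ?case by (intro exI[of _ "{z}"] exI[of _ id]) auto
  next
    case (insert A BB)
    then have BB: "BB \<subseteq> AA" and A: "A \<in> AA" by auto
    obtain Z r where Z: "separated BB Z" and cr: "card BB + 1 + card (r ` V) \<le> card Z + card V"
      and r: "\<And>x y. x \<in> V \<Longrightarrow> y \<in> V \<Longrightarrow> r x = (r y :: complex) \<Longrightarrow> (x, y) \<in> (adj BB)\<^sup>*"
      using insert.IH[OF BB] by blast
    have mono: "(adj BB)\<^sup>* \<subseteq> (adj (insert A BB))\<^sup>*"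
      using adj_mono[of BB "insert A BB"] rtrancl_mono by blast
    obtain u w where uw: "A \<inter> V = {u, w}" "u \<noteq> w" using ends_exist[OF A] .
    then have uV: "u \<in> V" "w \<in> V" by auto
    show ?case
    proof (cases "(u, w) \<in> (adj BB)\<^sup>*")
      case True
      obtain Z' where "separated (insert A BB) Z'" "card Z < card Z'"
        using separated_chord[OF BB A insert.hyps(2) uw(1) True Z] by blast
      then show ?thesis using cr r mono insert.hyps by (intro exI[of _ Z'] exI[of _ r]) auto
    next
      case False
      obtain Z' where Z': "separated (insert A BB) Z'" "card Z' = card Z"
        using move_separated[OF BB A Z] by blast
      \<comment> \<open>The arc joins two components: the class of \<open>u\<close> is relabelled as
        that of \<open>w\<close>. One label is lost as one arc is gained, and the number of faces
        stays.\<close>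
      define r' where "r' x = (if r x = r u then r w else r x)" for x
      have neq: "r u \<noteq> r w" using r uV False by blast
      have "r' ` V \<subseteq> r ` V - {r u}" using neq uV unfolding r'_def by auto
      then have "card (r' ` V) \<le> card (r ` V - {r u})" using finite_V by (simp add: card_mono)
      moreover have "Suc (card (r ` V - {r u})) = card (r ` V)"
        using finite_V uV by (intro card_Suc_Diff1) auto
      ultimately have "card (insert A BB) + 1 + card (r' ` V) \<le> card Z' + card V"
        using cr Z' insert.hyps by simp
      moreover have "(x, y) \<in> (adj (insert A BB))\<^sup>*" if xy: "x \<in> V" "y \<in> V" "r' x = r' y" for x y
      proof -
        let ?R = "(adj (insert A BB))\<^sup>*"
        have uwR: "(u, w) \<in> ?R" "(w, u) \<in> ?R"
          using uw unfolding adj_def by (auto intro!: r_into_rtrancl)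
        have R: "(a, b) \<in> ?R" if "a \<in> V" "b \<in> V" "r a = r b" for a b
          using r[OF that] mono by blast
        consider "r x = r y" | "r x = r u" "r w = r y" | "r x = r w" "r u = r y"
          using xy(3) unfolding r'_def by (metis (full_types))
        then show ?thesis
          using R xy uV uwR by cases (meson rtrancl_trans)+
      qed
      ultimately show ?thesis using Z'(1) by blast
    qed
  qed
qed

text \<open>The face of \<open>z\<close> borders \<open>A\<close>, expressed by the component of \<open>z\<close> running into \<open>A\<close> once
  \<open>A\<close> is deleted.\<close>

definition incident :: "complex \<Rightarrow> complex set \<Rightarrow> bool" where
  "incident z A \<longleftrightarrow> A \<in> AA \<and> (\<exists>a\<in>A - V. connected_component (- carrier (AA - {A})) z a)"

section \<open>Incidence of faces and arcs\<close>

lemma connected_arc_interior: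
  assumes "A \<in> AA" shows "connected (A - V)"
proof -
  obtain g where g: "arc g" "path_image g = A" "A \<inter> V = {pathstart g, pathfinish g}"
    using arc_AA assms by blast
  have "A - V = g ` {0<..<1}"
  proof -
    have "A - V = path_image g - {pathstart g, pathfinish g}" using g by blast
    also have "\<dots> = g ` ({0..1} - {0, 1})"
      using g(1) by (subst inj_on_image_set_diff[of g "{0..1}"])
        (auto simp: arc_def path_image_def pathstart_def pathfinish_def)
    also have "{0..1} - {0, 1} = {0<..<1::real}" by auto
    finally show ?thesis .
  qed
  moreover have "continuous_on {0<..<1} g"
    using g(1) by (auto simp: arc_def path_def intro: continuous_on_subset)
  ultimately show ?thesis by (simp add: connected_continuous_image)
qed

lemma carrier_remove:
  assumes "A \<in> AA" shows "(A - V) \<inter> carrier (AA - {A}) = {}" "carrier AA = carrier (AA - {A}) \<union> A"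
  using Int_carrier[of "AA - {A}" A] assms unfolding carrier_def by auto

text \<open>The open arc is connected and misses the rest of the graph, so deleting \<open>A\<close>
  merges all faces bordering it into one.\<close>

lemma incident_same_side:
  assumes "incident x A" "incident y A"
  shows "connected_component (- carrier (AA - {A})) x y"
proof -
  obtain a b where ab: "a \<in> A - V" "b \<in> A - V"
    "connected_component (- carrier (AA - {A})) x a" "connected_component (- carrier (AA - {A})) y b"
    and A: "A \<in> AA"
    using assms unfolding incident_def by blast
  have "connected_component (- carrier (AA - {A})) a b"
    unfolding connected_component_def
    using connected_arc_interior[OF A] carrier_remove(1)[OF A] ab(1,2)
    by (intro exI[of _ "A - V"]) auto
  then show ?thesis using ab(3,4) by (meson connected_component_sym connected_component_trans)
qed

text \<open>Three faces bordering \<open>A\<close> would merge after its deletion. If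
  \<open>A\<close> is a bridge, putting it back separates nothing. Otherwise \<open>A\<close> lies
  on a Jordan curve and two of the three sample points are on the same side.\<close>

lemma incident_faces_le_2:
  assumes Z: "separated AA Z" and A: "A \<in> AA"
  shows "card {z\<in>Z. incident z A} \<le> 2"
proof (rule ccontr)
  assume "\<not> ?thesis"
  then have "3 \<le> card {z\<in>Z. incident z A}" by simp
  then obtain T where "T \<subseteq> {z\<in>Z. incident z A}" "card T = 3"
    by (meson obtain_subset_with_card_n)
  then obtain x y z where xyz: "x \<noteq> y" "x \<noteq> z" "y \<noteq> z" "{x, y, z} \<subseteq> {z\<in>Z. incident z A}"
    by (auto simp: card_3_iff)
  have disc: "\<not> connected_component (- carrier AA) p q"
    if "p \<in> {x, y, z}" "q \<in> {x, y, z}" "p \<noteq> q" for p q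
    using that xyz(4) Z unfolding separated_def by blast
  have notin: "p \<notin> carrier AA" if "p \<in> {x, y, z}" for p
    using that xyz(4) Z unfolding separated_def by blast
  have cc: "connected_component (- carrier (AA - {A})) p q" if "p \<in> {x, y, z}" "q \<in> {x, y, z}" for p q
    using that incident_same_side xyz(4) by blast
  obtain u w where uw: "A \<inter> V = {u, w}" "u \<noteq> w" using ends_exist[OF A] .
  have ins: "insert A (AA - {A}) = AA" using A by auto
  show False
  proof (cases "(u, w) \<in> (adj (AA - {A}))\<^sup>*")
    case False
    have "connected_component (- carrier AA) x y"
      using bridge[of "AA - {A}" A u w x y] A uw False cc[of x y] notin[of x] notin[of y] ins
        carrier_remove(2)[OF A] by auto
    then show False using disc xyz(1) by blast
  next
    case True
    obtain S P where P: "trail (AA - {A}) u S P w" using reach_trail[OF True] uw by blast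
    note curve = trail_closed_curve[OF P _ A _ uw]
    obtain c where c: "simple_path c" "pathfinish c = pathstart c" "path_image c = A \<union> \<Union>P"
      using curve(1) by blast
    obtain I J where IJ: "connected I" "connected J" "I \<union> J = - path_image c"
      using Jordan_curve[OF c(1,2)] by metis
    have PA: "P \<subseteq> AA - {A}" using trail_subset[OF P] by blast
    then have sub: "path_image c \<subseteq> carrier AA" using c A unfolding carrier_def by auto
    have un: "carrier (AA - {A}) \<union> path_image c = carrier AA"
      using c(3) PA A unfolding carrier_def by blast
    have "A \<inter> carrier (AA - {A}) = {u, w}" using Int_carrier[of "AA - {A}" A] A uw by auto
    then have i: "carrier (AA - {A}) \<inter> path_image c = \<Union>P"
      using c(3) PA curve(3) unfolding carrier_def by blast
    \<comment> \<open>The rest of the graph and the closed curve meet exactly in the trail, which is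
      connected. So points separated by neither are not separated by their union, the whole
      graph.\<close>
    have same: "p = q" if "p \<in> {x, y, z}" "q \<in> {x, y, z}" "p \<in> I \<and> q \<in> I \<or> p \<in> J \<and> q \<in> J" for p q
    proof (rule ccontr)
      assume "p \<noteq> q"
      have "connected_component (- path_image c) p q"
        using that(3) IJ unfolding connected_component_def by (metis Un_upper1 Un_upper2)
      then have "connected_component (- carrier AA) p q"
        using Janiszewski[of "carrier (AA - {A})" "path_image c" p q] cc[OF that(1,2)] i un curve(2)
          compact_carrier[of "AA - {A}"] c(1) closed_simple_path_image by auto
      then show False using disc[OF that(1,2) \<open>p \<noteq> q\<close>] by blast
    qed
    have "p \<in> I \<or> p \<in> J" if "p \<in> {x, y, z}" for p using notin[OF that] sub IJ(3) by blast
    then have "x \<in> I \<or> x \<in> J" "y \<in> I \<or> y \<in> J" "z \<in> I \<or> z \<in> J" by auto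
    then show False using same xyz(1-3) by (metis insertCI)
  qed
qed

text \<open>If the bordering arcs \<open>I\<close> formed a forest, the complement of their carrier
  would be connected. Leaving the face of \<open>z\<close> inside it means passing a frontier point
  on an arc outside \<open>I\<close>, but such an arc borders the face. So the face fills this
  complement, and \<open>I\<close> is the whole graph, which has a cycle.\<close>

lemma incident_arcs_cyclic:
  assumes z: "z \<notin> carrier AA" and cyc: "cyclic AA"
  shows "cyclic {A. incident z A}"
proof (rule ccontr)
  define I where "I = {A. incident z A}"
  assume "\<not> cyclic {A. incident z A}"
  then have "\<not> cyclic I" unfolding I_def .
  have IAA: "I \<subseteq> AA" unfolding I_def incident_def by auto
  have conn: "connected (- carrier I)" by (rule connected_Compl_forest) fact+
  define F where "F = connected_component_set (- carrier AA) z"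
  have zF: "z \<in> F" unfolding F_def using z by simp
  have Fsub: "F \<subseteq> - carrier AA" unfolding F_def by (rule connected_component_subset)
  have "- carrier I \<subseteq> F"
  proof (rule ccontr)
    assume "\<not> ?thesis"
    moreover have "- carrier I \<inter> F \<noteq> {}" using zF z carrier_mono[OF IAA] by blast
    ultimately obtain p where p: "p \<in> - carrier I" "p \<in> frontier F"
      using connected_Int_frontier[OF conn, of F] by blast
    have "open F" unfolding F_def by (simp add: open_Compl_carrier open_connected_component)
    have "frontier F \<subseteq> carrier AA"
      unfolding F_def using frontier_of_connected_component_subset[of "- carrier AA" z]
        closed_carrier[of AA] frontier_subset_eq by (fastforce simp: frontier_complement)
    then obtain A where A: "A \<in> AA" "p \<in> A" "p \<notin> V" "A \<notin> I"
      using p unfolding carrier_def by blast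
    then have "p \<in> - carrier (AA - {A})" using carrier_remove(1)[OF A(1)] by blast
    then obtain e where e: "e > 0" "ball p e \<subseteq> - carrier (AA - {A})"
      using open_Compl_carrier[of "AA - {A}"] open_contains_ball by blast
    have "p \<in> closure F" using p(2) unfolding frontier_def by blast
    then obtain q where q: "q \<in> F" "q \<in> ball p e"
      using e(1) by (metis closure_approachable dist_commute mem_ball)
    have "connected_component (- carrier (AA - {A})) q p"
      using q(2) e by (metis centre_in_ball connected_ball connected_component_def)
    moreover have "connected_component (- carrier (AA - {A})) z q"
      using q(1) connected_component_of_subset carrier_mono[of "AA - {A}" AA] unfolding F_def
      by (metis Compl_subset_Compl_iff Diff_subset mem_Collect_eq)
    ultimately have "incident z A"
      unfolding incident_def using A by (meson DiffI connected_component_trans)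
    then show False using A(4) unfolding I_def by simp
  qed
  then have "carrier AA \<subseteq> carrier I" using Fsub by blast
  \<comment> \<open>An arc outside \<open>I\<close> but within its carrier would consist of vertices
    only, so it would be finite.\<close>
  have "A \<in> I" if A: "A \<in> AA" for A
  proof (rule ccontr)
    assume "A \<notin> I"
    then have "A \<subseteq> V"
      using Int_carrier[OF IAA A] \<open>carrier AA \<subseteq> carrier I\<close> A unfolding carrier_def by blast
    then have "finite A" using finite_V finite_subset by blast
    moreover obtain u w where "A \<inter> V = {u, w}" "u \<noteq> w" using ends_exist[OF A] .
    moreover have "connected A" using A arc_AA connected_arc_image by blast
    ultimately show False using connected_finite_iff_sing[of A] by auto
  qed
  then have "I = AA" using IAA by blast
  then show False using \<open>\<not> cyclic I\<close> cyc by simp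
qed

section \<open>Edge bounds from the face count\<close>

text \<open>The complement of a forest is connected, so at most one sample point is counted.\<close>

lemma forest_bound:
  assumes "\<not> cyclic AA" "V \<noteq> {}" shows "card AA + 1 \<le> card V"
proof -
  obtain Z and r :: "complex \<Rightarrow> complex"
    where Z: "separated AA Z" and cr: "card AA + 1 + card (r ` V) \<le> card Z + card V"
    using face_count[of AA] by blast
  have "card Z \<le> Suc 0"
    using connected_Compl_forest[of AA] assms(1) Z
    unfolding separated_def connected_iff_connected_component
    by (subst card_le_Suc0_iff_eq) blast+
  moreover have "card (r ` V) \<ge> 1"
    using assms(2) finite_V by (simp add: Suc_leI card_gt_0_iff)
  ultimately show ?thesis using cr by linarith
qed

text \<open>A cycle is an arc \<open>A\<close> together with a trail between its ends that avoids
  \<open>A\<close>, hence the \<open>Suc\<close>. The bound counts pairs of a face and a bordering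
  arc twice: at least \<open>g\<close> arcs per face, at most two faces per arc.\<close>

theorem girth_bound:
  assumes cyc: "cyclic AA"
    and girth: "\<And>A u w S P. A \<in> AA \<Longrightarrow> A \<inter> V = {u, w} \<Longrightarrow> trail (AA - {A}) u S P w \<Longrightarrow> g \<le> Suc (card P)"
  shows "g * (card AA + 2) \<le> 2 * card AA + g * card V"
proof -
  obtain Z and r :: "complex \<Rightarrow> complex"
    where Z: "separated AA Z" and cr: "card AA + 1 + card (r ` V) \<le> card Z + card V"
    using face_count[of AA] by blast
  have finZ: "finite Z" using Z unfolding separated_def by simp
  have "V \<noteq> {}" using cyc unfolding cyclic_def by auto
  then have "card (r ` V) \<ge> 1" using finite_V by (simp add: Suc_leI card_gt_0_iff)
  have "g \<le> card {A\<in>AA. incident z A}" if "z \<in> Z" for z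
  proof -
    have eq: "{A. incident z A} = {A\<in>AA. incident z A}" unfolding incident_def by blast
    have "cyclic {A\<in>AA. incident z A}"
      using incident_arcs_cyclic[of z] cyc that Z eq unfolding separated_def by auto
    then obtain A u w where A: "A \<in> AA" "incident z A" "A \<inter> V = {u, w}"
      and r: "(u, w) \<in> (adj ({A\<in>AA. incident z A} - {A}))\<^sup>*"
      unfolding cyclic_def by blast
    obtain S P where P: "trail ({A\<in>AA. incident z A} - {A}) u S P w"
      using reach_trail[OF r] A by blast
    have "trail (AA - {A}) u S P w"
      using P by (induction rule: trail.induct) (auto intro: trail.intros)
    then have "g \<le> Suc (card P)" using girth A by blast
    also have "\<dots> = card (insert A P)"
      using trail_subset[OF P] finite_AA by (subst card_insert_disjoint) (auto intro: finite_subset)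
    also have "\<dots> \<le> card {A\<in>AA. incident z A}"
      using trail_subset[OF P] A finite_AA by (intro card_mono) auto
    finally show ?thesis .
  qed
  then have "(\<Sum>z\<in>Z. g) \<le> (\<Sum>z\<in>Z. card {A\<in>AA. incident z A})" by (rule sum_mono)
  also have "\<dots> = (\<Sum>A\<in>AA. card {z\<in>Z. incident z A})"
    by (rule sum_multicount_gen[symmetric]) (auto simp: finZ finite_AA)
  also have "\<dots> \<le> (\<Sum>A\<in>AA. 2)"
    by (rule sum_mono) (rule incident_faces_le_2[OF Z])
  finally have "g * card Z \<le> 2 * card AA" by (simp add: mult.commute)
  moreover have "g * (card AA + 2) \<le> g * (card Z + card V)"
    using cr \<open>card (r ` V) \<ge> 1\<close> by (intro mult_le_mono2) linarith
  ultimately show ?thesis by (simp add: algebra_simps)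
qed

lemma trail_unfold:
  assumes "trail BB u S P w" "finite BB" "card P = Suc n"
  obtains A a S' P' where "A \<in> BB" "A \<inter> V = {u, a}" "trail BB a S' P' w" "card P' = n" "u \<notin> S'" "S = insert u S'"
  using assms(1)
proof (cases rule: trail.cases)
  case trail_Nil
  then show ?thesis using assms by simp
next
  case (trail_Cons a S' P' A)
  have "A \<notin> P'" using trail_carrier[OF trail_Cons(3)] trail_Cons(5,6) by blast
  moreover have "finite P'" using trail_subset[OF trail_Cons(3)] assms(2) finite_subset by blast
  ultimately have "card P' = n" using trail_Cons(2) assms(3) by simp
  then show ?thesis using that trail_Cons by blast
qed

lemma trail_unfold_0:
  assumes "trail BB u S P w" "finite BB" "card P = 0"
  shows "u = w"
  using assms(1)
proof (cases rule: trail.cases)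
  case (trail_Cons a S' P' A)
  have "finite P" using trail_subset[OF assms(1)] assms(2) finite_subset by blast
  then show ?thesis using trail_Cons(2) assms(3) by simp
qed simp

text \<open>A trail without arcs would make \<open>A\<close> a loop, and a trail with one arc would
  make that arc parallel to \<open>A\<close>.\<close>

lemma trail_length_ge_2:
  assumes simple: "\<And>A B. A \<in> AA \<Longrightarrow> B \<in> AA \<Longrightarrow> A \<inter> V = B \<inter> V \<Longrightarrow> A = B"
    and A: "A \<in> AA" "A \<inter> V = {u, w}" and tr: "trail (AA - {A}) u S P w"
  shows "2 \<le> card P"
proof (rule ccontr)
  have fin: "finite (AA - {A})" using finite_AA by simp
  assume "\<not> 2 \<le> card P"
  then consider "card P = 0" | "card P = Suc 0" by linarith
  then show False
  proof cases
    case 1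
    then show ?thesis using trail_unfold_0[OF tr] ends_neq[OF A] finite_AA by auto
  next
    case 2
    obtain B a S' P' where B: "B \<in> AA - {A}" "B \<inter> V = {u, a}" "trail (AA - {A}) a S' P' w" "card P' = 0"
      by (rule trail_unfold[OF tr fin 2]) (rule that)
    then have "a = w" using trail_unfold_0[OF _ fin] by blast
    then show ?thesis using simple[of A B] A B by auto
  qed
qed

text \<open>Girth 3. A forest has at most \<open>card V - 1\<close> arcs, which suffices from three
  vertices on.\<close>

theorem card_arcs_bound:
  assumes simple: "\<And>A B. A \<in> AA \<Longrightarrow> B \<in> AA \<Longrightarrow> A \<inter> V = B \<inter> V \<Longrightarrow> A = B"
    and n: "3 \<le> card V"
  shows "card AA + 6 \<le> 3 * card V"
proof (cases "cyclic AA")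
  case True
  then have "3 * (card AA + 2) \<le> 2 * card AA + 3 * card V"
    using trail_length_ge_2[OF simple] by (intro girth_bound) fastforce+
  then show ?thesis by simp
next
  case False
  then show ?thesis using forest_bound n by fastforce
qed

text \<open>Every arc changes sides, so the parity of the length tells whether the ends lie on the
  same side.\<close>

lemma trail_parity:
  assumes "trail BB u S P w" "finite BB"
    and bip: "\<And>A x y. A \<in> BB \<Longrightarrow> A \<inter> V = {x, y} \<Longrightarrow> x \<in> L \<longleftrightarrow> y \<notin> L"
  shows "even (card P) \<longleftrightarrow> (u \<in> L \<longleftrightarrow> w \<in> L)"
  using assms(1)
proof (induction rule: trail.induct)
  case (trail_Cons w S P x A u)
  have "A \<notin> P" using trail_carrier[OF trail_Cons(1)] trail_Cons(3,4) by blast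
  moreover have "finite P" using trail_subset[OF trail_Cons(1)] assms(2) finite_subset by blast
  ultimately show ?case using trail_Cons.IH bip[OF trail_Cons(2,3)] by auto
qed simp

text \<open>A trail closing up an arc has odd length at least 2, and length 3 is the forbidden
  4-cycle; so the length is at least 5 and the girth at least 6. For forests the bound holds from
  four vertices on.\<close>

theorem card_arcs_bound_bipartite:
  assumes simple: "\<And>A B. A \<in> AA \<Longrightarrow> B \<in> AA \<Longrightarrow> A \<inter> V = B \<inter> V \<Longrightarrow> A = B"
    and bip: "\<And>A x y. A \<in> AA \<Longrightarrow> A \<inter> V = {x, y} \<Longrightarrow> x \<in> L \<longleftrightarrow> y \<notin> L"
    and no_C4: "\<And>A B C D a b x y. \<lbrakk>A \<in> AA; B \<in> AA; C \<in> AA; D \<in> AA; A \<inter> V = {a, x}; B \<inter> V = {a, y};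
      C \<inter> V = {b, x}; D \<inter> V = {b, y}; a \<in> L; b \<in> L; x \<notin> L; y \<notin> L; a \<noteq> b; x \<noteq> y\<rbrakk> \<Longrightarrow> False"
    and n: "4 \<le> card V"
  shows "2 * card AA + 6 \<le> 3 * card V"
proof (cases "cyclic AA")
  case True
  have "6 \<le> Suc (card P)" if A: "A \<in> AA" "A \<inter> V = {u, w}" and tr: "trail (AA - {A}) u S P w" for A u w S P
  proof (rule ccontr)
    have fin: "finite (AA - {A})" using finite_AA by simp
    assume "\<not> ?thesis"
    moreover have "odd (card P)" using trail_parity[OF tr fin, of L] bip A by blast
    moreover have "2 \<le> card P" using trail_length_ge_2[OF simple A tr] by blast
    ultimately have "card P = 3" by presburger
    then have c3: "card P = Suc (Suc (Suc 0))" by simp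
    obtain B b S1 P1 where B: "B \<in> AA - {A}" "B \<inter> V = {u, b}" "u \<notin> S1"
      and tr1: "trail (AA - {A}) b S1 P1 w" "card P1 = Suc (Suc 0)"
      by (rule trail_unfold[OF tr fin c3]) (rule that)
    obtain C c S2 P2 where C: "C \<in> AA - {A}" "C \<inter> V = {b, c}" "b \<notin> S2" "S1 = insert b S2"
      and tr2: "trail (AA - {A}) c S2 P2 w" "card P2 = Suc 0"
      by (rule trail_unfold[OF tr1(1) fin tr1(2)]) (rule that)
    obtain D d S3 P3 where D: "D \<in> AA - {A}" "D \<inter> V = {c, d}"
      and tr3: "trail (AA - {A}) d S3 P3 w" "card P3 = 0"
      by (rule trail_unfold[OF tr2(1) fin tr2(2)]) (rule that)
    have "d = w" using trail_unfold_0[OF tr3(1) fin tr3(2)] .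
    \<comment> \<open>The cycle is \<open>u\<close>, \<open>b\<close>, \<open>c\<close>,
      \<open>w\<close>. Its opposite corners differ because a trail repeats no vertex.\<close>
    have "b \<noteq> w" using C(3) trail_subset[OF tr2(1)] by blast
    have "c \<in> S1" using C(4) trail_subset[OF tr2(1)] by blast
    then have "u \<noteq> c" using B(3) by blast
    note ends = A(2) B(2) C(2) D(2)[unfolded \<open>d = w\<close>]
    have arcs: "B \<in> AA" "C \<in> AA" "D \<in> AA" using B C D by auto
    note sides = bip[OF A(1) ends(1)] bip[OF arcs(1) ends(2)] bip[OF arcs(2) ends(3)]
    show False
    \<comment> \<open>The side of \<open>u\<close> decides which pair of opposite corners,
      \<open>u\<close> and \<open>c\<close> or \<open>b\<close> and \<open>w\<close>, plays the role
      of \<open>a\<close> and \<open>b\<close> in \<open>no_C4\<close>.\<close>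
    proof (cases "u \<in> L")
      case True
      then have "w \<notin> L" "b \<notin> L" "c \<in> L" using sides by auto
      then show ?thesis
        using no_C4[of A B D C u w b c] A(1) arcs ends True \<open>u \<noteq> c\<close> \<open>b \<noteq> w\<close>
        by (auto simp: insert_commute)
    next
      case False
      then have "w \<in> L" "b \<in> L" "c \<notin> L" using sides by auto
      then show ?thesis
        using no_C4[of A D B C w u c b] A(1) arcs ends False \<open>u \<noteq> c\<close> \<open>b \<noteq> w\<close>
        by (auto simp: insert_commute)
    qed
  qed
  then have "6 * (card AA + 2) \<le> 2 * card AA + 6 * card V"
    using True by (intro girth_bound) blast+
  then show ?thesis by simp
next
  case False
  then show ?thesis using forest_bound n by fastforce
qed

end

section \<open>Counting edges and crossings\<close>

abbreviation inner_curve :: "(real \<Rightarrow> 'b) \<Rightarrow> 'b set" where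
  "inner_curve g \<equiv> g ` {0<..<1}"

lemma path_image_inner_curve: "path_image g = inner_curve g \<union> {pathstart g, pathfinish g}"
proof -
  have "{0..1} = {0<..<1} \<union> {0, 1::real}" by auto
  then show ?thesis unfolding path_image_def pathstart_def pathfinish_def by auto
qed

text \<open>A 1-planar drawing moved to \<open>complex\<close>, where \<open>plane_graph\<close>
  lives. The ends of an edge are stated as a set, so the direction of a curve does not
  matter.\<close>

locale drawing =
  fixes V :: "'a set" and E :: "'a set set"
    and pos :: "'a \<Rightarrow> complex" and \<gamma> :: "'a set \<Rightarrow> real \<Rightarrow> complex"
  assumes finite_V: "finite V"
    and edge: "\<And>e. e \<in> E \<Longrightarrow> e \<subseteq> V \<and> card e = 2"
    and inj_pos: "inj_on pos V"
    and arc: "\<And>e. e \<in> E \<Longrightarrow> arc (\<gamma> e)"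
    and ends: "\<And>e. e \<in> E \<Longrightarrow> {pathstart (\<gamma> e), pathfinish (\<gamma> e)} = pos ` e"
    and avoid: "\<And>e. e \<in> E \<Longrightarrow> inner_curve (\<gamma> e) \<inter> pos ` V = {}"
    and adjacent: "\<And>e f. e \<in> E \<Longrightarrow> f \<in> E \<Longrightarrow> e \<noteq> f \<Longrightarrow> e \<inter> f \<noteq> {}
      \<Longrightarrow> inner_curve (\<gamma> e) \<inter> inner_curve (\<gamma> f) = {}"
    and one_point: "\<And>e. e \<in> E \<Longrightarrow> \<exists>p. (\<Union>f\<in>E - {e}. inner_curve (\<gamma> e) \<inter> inner_curve (\<gamma> f)) \<subseteq> {p}"
    and one_edge: "\<And>e. e \<in> E \<Longrightarrow>
      \<exists>g. {f \<in> E - {e}. inner_curve (\<gamma> e) \<inter> inner_curve (\<gamma> f) \<noteq> {}} \<subseteq> {g}"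
begin

definition cross :: "'a set \<Rightarrow> 'a set \<Rightarrow> bool" where
  "cross e f \<longleftrightarrow> e \<in> E \<and> f \<in> E \<and> e \<noteq> f \<and> inner_curve (\<gamma> e) \<inter> inner_curve (\<gamma> f) \<noteq> {}"

definition crossing_pairs :: "'a set set set" where
  "crossing_pairs = {{e, f} | e f. cross e f}"

definition crossed :: "'a set set" where
  "crossed = {e. \<exists>f. cross e f}"

lemma finite_E: "finite E"
  using edge finite_V by (meson PowI finite_Pow_iff finite_subset subsetI)

lemma cross_sym: "cross e f \<Longrightarrow> cross f e"
  unfolding cross_def by blast

lemma cross_unique: "cross e f \<Longrightarrow> cross e g \<Longrightarrow> f = g"
  using one_edge[of e] unfolding cross_def by blast

lemma cross_disjoint: "cross e f \<Longrightarrow> e \<inter> f = {}"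
  using adjacent[of e f] unfolding cross_def by blast

lemma crossed_subset: "crossed \<subseteq> E"
  unfolding crossed_def cross_def by auto

lemma crossing_pairs_memberE:
  assumes "X \<in> crossing_pairs" "e \<in> X"
  obtains f where "X = {e, f}" "cross e f"
proof -
  obtain a b where "X = {a, b}" "cross a b" using assms(1) unfolding crossing_pairs_def by blast
  then show thesis using that[of a] that[of b] assms(2) cross_sym[of a b] by auto
qed

lemma crossing_pairs_disjoint:
  assumes "X \<in> crossing_pairs" "Y \<in> crossing_pairs" "X \<noteq> Y" shows "X \<inter> Y = {}"
proof (rule ccontr)
  assume "X \<inter> Y \<noteq> {}"
  then obtain e where e: "e \<in> X" "e \<in> Y" by blast
  obtain f where f: "X = {e, f}" "cross e f" using crossing_pairs_memberE[OF assms(1) e(1)] .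
  obtain g where g: "Y = {e, g}" "cross e g" using crossing_pairs_memberE[OF assms(2) e(2)] .
  show False using cross_unique[OF f(2) g(2)] f g assms(3) by simp
qed

lemma Union_crossing_pairs: "\<Union>crossing_pairs = crossed"
  unfolding crossing_pairs_def crossed_def using cross_sym by blast

lemma finite_crossing_pairs: "finite crossing_pairs"
  using Union_crossing_pairs crossed_subset finite_E by (metis finite_UnionD finite_subset)

text \<open>An edge crosses at most one other, so the crossing pairs partition the crossed
  edges.\<close>

lemma card_crossed: "card crossed = 2 * card crossing_pairs"
proof -
  have "card X = 2" if "X \<in> crossing_pairs" for X
    using that unfolding crossing_pairs_def cross_def by (auto simp: card_2_iff)
  then show ?thesis
    using card_partition[of crossing_pairs 2] crossing_pairs_disjoint finite_crossing_pairs
      Union_crossing_pairs crossed_subset finite_E finite_subset by metis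
qed

lemma path_image_Int_pos:
  assumes "e \<in> E" shows "path_image (\<gamma> e) \<inter> pos ` V = pos ` e"
  unfolding path_image_inner_curve ends[OF assms] using avoid[OF assms] edge[OF assms] by blast

lemma pos_image_inj: "e \<in> E \<Longrightarrow> f \<in> E \<Longrightarrow> pos ` e = pos ` f \<Longrightarrow> e = f"
  using inj_pos edge by (meson inj_on_image_eq_iff)

lemma path_image_Int:
  assumes "e \<in> E" "f \<in> E" "e \<noteq> f"
  shows "path_image (\<gamma> e) \<inter> path_image (\<gamma> f) \<subseteq> pos ` V \<union> (inner_curve (\<gamma> e) \<inter> inner_curve (\<gamma> f))"
  using edge[OF assms(1)] edge[OF assms(2)]
  unfolding path_image_inner_curve ends[OF assms(1)] ends[OF assms(2)] by blast

theorem edges_le_crossings: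
  assumes "3 \<le> card V"
  shows "card E + 6 \<le> 3 * card V + card crossing_pairs"
proof -
  \<comment> \<open>One edge is picked from every crossing; two edges that still cross would form a
    pair from which neither was picked.\<close>
  define R where "R = (\<lambda>X. SOME e. e \<in> X) ` crossing_pairs"
  define F where "F = E - R"
  define AA where "AA = (\<lambda>e. path_image (\<gamma> e)) ` F"
  have F: "F \<subseteq> E" unfolding F_def by auto
  have nocross: "inner_curve (\<gamma> e) \<inter> inner_curve (\<gamma> f) = {}" if "e \<in> F" "f \<in> F" "e \<noteq> f" for e f
  proof (rule ccontr)
    assume "\<not> ?thesis"
    then have "cross e f" using that F unfolding cross_def by blast
    then have X: "{e, f} \<in> crossing_pairs" unfolding crossing_pairs_def by blast
    have "(SOME g. g \<in> {e, f}) \<in> {e, f}" by (rule someI[of _ e]) simp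
    moreover have "(SOME g. g \<in> {e, f}) \<in> R" using X unfolding R_def by (rule imageI)
    ultimately have "e \<in> R \<or> f \<in> R" by auto
    then show False using that unfolding F_def by auto
  qed
  have endsF: "A \<inter> pos ` V = pos ` e" if "A = path_image (\<gamma> e)" "e \<in> F" for A e
    using that path_image_Int_pos F by blast
  interpret G: plane_graph "pos ` V" AA
  proof
    show "finite (pos ` V)" "finite AA" unfolding AA_def F_def using finite_V finite_E by auto
    fix A assume "A \<in> AA"
    then obtain e where e: "e \<in> F" "A = path_image (\<gamma> e)" unfolding AA_def by blast
    then show "\<exists>g. arc g \<and> path_image g = A \<and> A \<inter> pos ` V = {pathstart g, pathfinish g}"
      using endsF F arc ends by (metis subsetD)
    fix B assume "B \<in> AA" "A \<noteq> B"
    then obtain f where "f \<in> F" "B = path_image (\<gamma> f)" unfolding AA_def by blast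
    then show "A \<inter> B \<subseteq> pos ` V"
      using path_image_Int[of e f] nocross[of e f] e F \<open>A \<noteq> B\<close> by blast
  qed
  have "card AA = card F" unfolding AA_def
  proof (rule card_image, rule inj_onI)
    fix e f assume "e \<in> F" "f \<in> F" "path_image (\<gamma> e) = path_image (\<gamma> f)"
    then show "e = f" using pos_image_inj endsF F by (metis subsetD)
  qed
  moreover have "card AA + 6 \<le> 3 * card (pos ` V)"
  proof (rule G.card_arcs_bound)
    fix A B assume AB: "A \<in> AA" "B \<in> AA" "A \<inter> pos ` V = B \<inter> pos ` V"
    then obtain e f where ef: "A = path_image (\<gamma> e)" "e \<in> F" "B = path_image (\<gamma> f)" "f \<in> F"
      unfolding AA_def by auto
    then have "pos ` e = pos ` f" using AB(3) endsF[OF ef(1,2)] endsF[OF ef(3,4)] by simp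
    then show "A = B" using pos_image_inj[of e f] ef F by auto
  qed (use assms card_image[OF inj_pos] in simp)
  moreover have "card E \<le> card F + card R"
    unfolding F_def using card_Un_le[of "E - R" R] card_mono[of "(E - R) \<union> R" E] finite_E
      finite_crossing_pairs unfolding R_def by fastforce
  moreover have "card R \<le> card crossing_pairs"
    unfolding R_def by (rule card_image_le[OF finite_crossing_pairs])
  ultimately show ?thesis using card_image[OF inj_pos] by simp
qed

section \<open>Half-edges: the bipartite graph of vertices and crossing points\<close>

text \<open>For a crossed edge the parameter is unique, since the curve is injective and has one
  crossing point; for other edges it is arbitrary.\<close>

definition cross_param :: "'a set \<Rightarrow> real" where
  "cross_param e = (SOME t. t \<in> {0<..<1} \<and> (\<exists>f. cross e f \<and> \<gamma> e t \<in> inner_curve (\<gamma> f)))"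

definition cross_pt :: "'a set \<Rightarrow> complex" where
  "cross_pt e = \<gamma> e (cross_param e)"

text \<open>The part of the edge \<open>e\<close> between its endpoint \<open>v\<close> and its crossing point.\<close>

definition half :: "'a set \<Rightarrow> 'a \<Rightarrow> complex set" where
  "half e v = (if pathstart (\<gamma> e) = pos v then \<gamma> e ` {0..cross_param e} else \<gamma> e ` {cross_param e..1})"

lemma cross_param:
  assumes "cross e f" shows "cross_param e \<in> {0<..<1}" "cross_pt e \<in> inner_curve (\<gamma> f)"
proof -
  have "\<exists>t. t \<in> {0<..<1} \<and> (\<exists>f. cross e f \<and> \<gamma> e t \<in> inner_curve (\<gamma> f))"
    using assms unfolding cross_def by blast
  from someI_ex[OF this] show "cross_param e \<in> {0<..<1}" "cross_pt e \<in> inner_curve (\<gamma> f)"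
    unfolding cross_param_def[symmetric] cross_pt_def using cross_unique[OF assms] by auto
qed

lemma cross_pt_inner: "e \<in> crossed \<Longrightarrow> cross_pt e \<in> inner_curve (\<gamma> e)"
  using cross_param(1) unfolding crossed_def cross_pt_def by blast

lemma inner_Int_cross:
  assumes "cross e f" shows "inner_curve (\<gamma> e) \<inter> inner_curve (\<gamma> f) = {cross_pt e}"
proof -
  obtain p where "(\<Union>g\<in>E - {e}. inner_curve (\<gamma> e) \<inter> inner_curve (\<gamma> g)) \<subseteq> {p}"
    using one_point assms unfolding cross_def by blast
  then have "inner_curve (\<gamma> e) \<inter> inner_curve (\<gamma> f) \<subseteq> {p}" using assms unfolding cross_def by blast
  moreover have "cross_pt e \<in> inner_curve (\<gamma> e) \<inter> inner_curve (\<gamma> f)"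
    using cross_param(2)[OF assms] cross_pt_inner assms unfolding crossed_def by blast
  ultimately show ?thesis by blast
qed

lemma cross_pt_eq: "cross e f \<Longrightarrow> cross_pt e = cross_pt f"
  using inner_Int_cross[of e f] inner_Int_cross[OF cross_sym, of e f] by blast

lemma cross_pt_eqD:
  assumes "e \<in> crossed" "f \<in> crossed" "cross_pt e = cross_pt f" "e \<noteq> f"
  shows "cross e f"
  using assms cross_pt_inner crossed_subset unfolding cross_def by (metis disjoint_iff subsetD)

lemma half_arc:
  assumes e: "e \<in> crossed" and v: "v \<in> e"
  shows "\<exists>g. arc g \<and> path_image g = half e v \<and> {pathstart g, pathfinish g} = {pos v, cross_pt e}"
proof -
  let ?t = "cross_param e"
  have t: "0 < ?t" "?t < 1" using e cross_param(1) unfolding crossed_def by auto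
  have eE: "e \<in> E" using e crossed_subset by blast
  have a: "arc (\<gamma> e)" by (rule arc[OF eE])
  have "arc (subpath 0 ?t (\<gamma> e))" "arc (subpath ?t 1 (\<gamma> e))"
    using t arc_subpath_arc[OF a] by auto
  moreover have "pathstart (\<gamma> e) = pos v \<or> pathfinish (\<gamma> e) = pos v"
    using ends[OF eE] v by (metis imageI insertE singletonD)
  ultimately show ?thesis
  proof (cases "pathstart (\<gamma> e) = pos v")
    case True
    moreover from this have "\<gamma> e 0 = pos v" by (simp add: pathstart_def)
    ultimately show ?thesis using t \<open>arc (subpath 0 ?t (\<gamma> e))\<close>
      by (intro exI[of _ "subpath 0 ?t (\<gamma> e)"])
        (simp add: half_def path_image_subpath cross_pt_def)
  next
    case False
    moreover from this have "\<gamma> e 1 = pos v"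
      using \<open>pathstart (\<gamma> e) = pos v \<or> pathfinish (\<gamma> e) = pos v\<close> by (simp add: pathfinish_def)
    ultimately show ?thesis using t \<open>arc (subpath ?t 1 (\<gamma> e))\<close>
      by (intro exI[of _ "subpath ?t 1 (\<gamma> e)"])
        (simp add: half_def path_image_subpath cross_pt_def insert_commute)
  qed
qed

lemma half_subset:
  assumes "e \<in> crossed" shows "half e v \<subseteq> path_image (\<gamma> e)"
proof -
  have "0 < cross_param e" "cross_param e < 1" using assms cross_param(1) unfolding crossed_def by auto
  then show ?thesis unfolding half_def path_image_def by (auto intro!: image_mono)
qed

lemma half_Int_half:
  assumes e: "e \<in> crossed" and v: "v \<in> e" "w \<in> e" "v \<noteq> w"
  shows "half e v \<inter> half e w \<subseteq> {cross_pt e}"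
proof -
  let ?t = "cross_param e"
  have t: "0 < ?t" "?t < 1" using e cross_param(1) unfolding crossed_def by auto
  have eE: "e \<in> E" using e crossed_subset by blast
  then have inj: "inj_on (\<gamma> e) {0..1}" using arc unfolding arc_def by blast
  have "pos v \<noteq> pos w" using inj_pos v edge[OF eE] by (meson inj_onD subsetD)
  moreover have "e = {v, w}" using edge[OF eE] v by (auto simp: card_2_iff)
  then have "{pathstart (\<gamma> e), pathfinish (\<gamma> e)} = {pos v, pos w}" using ends[OF eE] by simp
  \<comment> \<open>Exactly one of \<open>v\<close> and \<open>w\<close> is the start, so the two
    halves are the initial and the final piece of the curve.\<close>
  ultimately have "pathstart (\<gamma> e) = pos v \<longleftrightarrow> pathstart (\<gamma> e) \<noteq> pos w"
    by (metis doubleton_eq_iff)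
  then have "half e v \<inter> half e w = \<gamma> e ` {0..?t} \<inter> \<gamma> e ` {?t..1}"
    unfolding half_def by auto
  also have "\<dots> = \<gamma> e ` ({0..?t} \<inter> {?t..1})"
    using t by (intro inj_on_image_Int[OF inj, symmetric]) auto
  also have "{0..?t} \<inter> {?t..1} = {?t}" using t by auto
  finally show ?thesis unfolding cross_pt_def by simp
qed

text \<open>The other end of \<open>e\<close> lies on the other half, and the halves meet only in
  the crossing point, which is not a vertex.\<close>

lemma half_Int_pos:
  assumes e: "e \<in> crossed" and v: "v \<in> e"
  shows "half e v \<inter> pos ` V = {pos v}"
proof -
  have eE: "e \<in> E" using e crossed_subset by blast
  have vV: "v \<in> V" using v edge[OF eE] by blast
  have mem: "pos w \<in> half e w" if "w \<in> e" for w
    using half_arc[OF e that] by (metis insertCI insertE pathfinish_in_path_image pathstart_in_path_image singletonD)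
  have "cross_pt e \<notin> pos ` V" using cross_pt_inner[OF e] avoid[OF eE] by blast
  have sub: "half e v \<inter> pos ` V \<subseteq> pos ` e"
    using half_subset[OF e] path_image_Int_pos[OF eE] by blast
  have only: "w = v" if "w \<in> e" "pos w \<in> half e v" for w
  proof (rule ccontr)
    assume "w \<noteq> v"
    then have "pos w = cross_pt e"
      using half_Int_half[OF e that(1) v] mem[OF that(1)] that(2) by blast
    moreover have "pos w \<in> pos ` V" using that(1) edge[OF eE] by blast
    ultimately show False using \<open>cross_pt e \<notin> pos ` V\<close> by simp
  qed
  have "half e v \<inter> pos ` V \<subseteq> {pos v}"
  proof
    fix x assume x: "x \<in> half e v \<inter> pos ` V"
    then obtain w where "w \<in> e" "x = pos w" using sub by blast
    then show "x \<in> {pos v}" using only[of w] x by simp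
  qed
  then show ?thesis using mem[OF v] vV by blast
qed

definition bip_vertices :: "complex set" where
  "bip_vertices = pos ` V \<union> cross_pt ` crossed"

text \<open>A crossing point of another edge \<open>f\<close> lying on \<open>e\<close> makes
  \<open>e\<close> and \<open>f\<close> cross, and then their crossing points coincide.\<close>

lemma half_Int_vertices:
  assumes e: "e \<in> crossed" and v: "v \<in> e"
  shows "half e v \<inter> bip_vertices = {pos v, cross_pt e}"
proof -
  have eE: "e \<in> E" using e crossed_subset by blast
  have "cross_pt e \<in> half e v"
    using half_arc[OF e v] by (metis insertCI insertE pathfinish_in_path_image pathstart_in_path_image singletonD)
  moreover have "cross_pt f = cross_pt e" if f: "f \<in> crossed" "cross_pt f \<in> half e v" for f
  proof (cases "f = e")
    case False
    have fE: "f \<in> E" using f crossed_subset by blast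
    have "cross_pt f \<in> inner_curve (\<gamma> f)" using cross_pt_inner f by blast
    moreover from this have "cross_pt f \<notin> pos ` V" using avoid[OF fE] by blast
    moreover have "cross_pt f \<in> path_image (\<gamma> e)" using f half_subset[OF e] by blast
    ultimately have "cross_pt f \<in> inner_curve (\<gamma> e)"
      using ends[OF eE] edge[OF eE] unfolding path_image_inner_curve by blast
    then have "cross e f" using \<open>cross_pt f \<in> inner_curve (\<gamma> f)\<close> eE fE False unfolding cross_def by blast
    then show ?thesis using cross_pt_eq by simp
  qed simp
  ultimately show ?thesis
    using half_Int_pos[OF e v] e unfolding bip_vertices_def by blast
qed

text \<open>No two half-edges are parallel: edges with the same crossing point are equal or cross,
  and crossing edges have no common end \<open>v\<close>.\<close>

lemma half_inj:
  assumes "e \<in> crossed" "v \<in> e" "f \<in> crossed" "w \<in> f"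
    and eq: "half e v \<inter> bip_vertices = half f w \<inter> bip_vertices"
  shows "e = f \<and> v = w"
proof -
  have eE: "e \<in> E" and fE: "f \<in> E" using assms(1,3) crossed_subset by auto
  have "half e v \<inter> pos ` V = half f w \<inter> pos ` V" using eq unfolding bip_vertices_def by blast
  then have pvw: "pos v = pos w"
    using half_Int_pos[OF assms(1,2)] half_Int_pos[OF assms(3,4)] by simp
  moreover have "v \<in> V" "w \<in> V" using edge[OF eE] edge[OF fE] assms(2,4) by auto
  ultimately have vw: "v = w" using inj_pos by (meson inj_onD)
  have "cross_pt e \<noteq> pos v" "cross_pt f \<noteq> pos v"
    using cross_pt_inner[OF assms(1)] cross_pt_inner[OF assms(3)] avoid[OF eE] avoid[OF fE] \<open>v \<in> V\<close>
    by (metis IntI empty_iff imageI)+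
  then have "cross_pt e = cross_pt f"
    using eq half_Int_vertices[OF assms(1,2)] half_Int_vertices[OF assms(3,4)] pvw
    by (metis doubleton_eq_iff)
  then have "e = f"
    using cross_pt_eqD[OF assms(1,3)] cross_disjoint[of e f] assms(2,4) vw by blast
  then show ?thesis using vw by blast
qed

theorem crossings_bound:
  assumes n: "4 \<le> card V"
    and overlap: "\<And>X Y. X \<in> crossing_pairs \<Longrightarrow> Y \<in> crossing_pairs \<Longrightarrow> X \<noteq> Y \<Longrightarrow> card (\<Union>X \<inter> \<Union>Y) \<le> 1"
  shows "5 * card crossing_pairs + 6 \<le> 3 * card V"
proof -
  \<comment> \<open>Two halves for each crossed edge, so four for each crossing.\<close>
  define J where "J = Sigma crossed (\<lambda>e. e)"
  define AA where "AA = (\<lambda>(e, v). half e v) ` J"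
  let ?W = bip_vertices
  have finc: "finite crossed" using crossed_subset finite_E finite_subset by blast
  have fine: "finite e \<and> card e = 2" if "e \<in> crossed" for e
    using that crossed_subset edge finite_V by (meson finite_subset subsetD)
  have "card J = (\<Sum>e\<in>crossed. card e)"
    unfolding J_def using finc fine by (intro card_SigmaI) auto
  also have "\<dots> = 4 * card crossing_pairs" using fine card_crossed by simp
  finally have cardJ: "card J = 4 * card crossing_pairs" .
  have AAE: "\<exists>e v. A = half e v \<and> e \<in> crossed \<and> v \<in> e" if "A \<in> AA" for A
    using that unfolding AA_def J_def by auto
  have simple: "A = B" if "A \<in> AA" "B \<in> AA" "A \<inter> ?W = B \<inter> ?W" for A B
    using AAE[OF that(1)] AAE[OF that(2)] that(3) half_inj by blast
  have finV: "finite ?W" unfolding bip_vertices_def using finite_V finc by simp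
  have finAA: "finite AA" unfolding AA_def J_def using finc fine by auto
  interpret G: plane_graph ?W AA
  proof
    fix A assume "A \<in> AA"
    then obtain e v where ev: "A = half e v" "e \<in> crossed" "v \<in> e" using AAE[OF \<open>A \<in> AA\<close>] by blast
    then show "\<exists>g. arc g \<and> path_image g = A \<and> A \<inter> ?W = {pathstart g, pathfinish g}"
      using half_arc half_Int_vertices by metis
    fix B assume "B \<in> AA" "A \<noteq> B"
    then obtain f w where fw: "B = half f w" "f \<in> crossed" "w \<in> f" using AAE[OF \<open>B \<in> AA\<close>] by blast
    show "A \<inter> B \<subseteq> ?W"
    proof (cases "e = f")
      case True
      then have "A \<inter> B \<subseteq> {cross_pt e}" using half_Int_half[of e v w] ev fw \<open>A \<noteq> B\<close> by blast
      then show ?thesis using ev(2) unfolding bip_vertices_def by blast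
    next
      case False
      have EE: "e \<in> E" "f \<in> E" using ev fw crossed_subset by auto
      have "inner_curve (\<gamma> e) \<inter> inner_curve (\<gamma> f) \<subseteq> {cross_pt e}"
        using inner_Int_cross[of e f] EE False unfolding cross_def by blast
      then have "path_image (\<gamma> e) \<inter> path_image (\<gamma> f) \<subseteq> ?W"
        using path_image_Int[OF EE False] ev(2) unfolding bip_vertices_def by blast
      then show ?thesis using half_subset[OF ev(2), of v] half_subset[OF fw(2), of w] ev(1) fw(1) by blast
    qed
  qed (fact finV finAA)+
  have not_pos: "cross_pt e \<notin> pos ` V" if "e \<in> crossed" for e
    using that cross_pt_inner avoid crossed_subset by blast
  have link: "\<exists>e v. e \<in> crossed \<and> v \<in> e \<and> a = pos v \<and> x = cross_pt e"
    if "A \<in> AA" "A \<inter> ?W = {a, x}" "a \<in> pos ` V" "x \<notin> pos ` V" for A a x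
  proof -
    note A = that
    obtain e v where ev: "A = half e v" "e \<in> crossed" "v \<in> e" using AAE[OF A(1)] by blast
    then have "{a, x} = {pos v, cross_pt e}" using half_Int_vertices[OF ev(2,3)] A(2) by simp
    moreover have "cross_pt e \<notin> pos ` V" using not_pos ev by blast
    ultimately show ?thesis using ev A(3,4) by (metis doubleton_eq_iff)
  qed
  have "inj_on (\<lambda>(e, v). half e v) J"
  proof (rule inj_onI)
    fix p q assume "p \<in> J" "q \<in> J" "(case p of (e, v) \<Rightarrow> half e v) = (case q of (e, v) \<Rightarrow> half e v)"
    then show "p = q"
      using half_inj[of "fst p" "snd p" "fst q" "snd q"] unfolding J_def by (auto split: prod.splits)
  qed
  then have "card AA = 4 * card crossing_pairs" unfolding AA_def using card_image cardJ by metis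
  moreover have "2 * card AA + 6 \<le> 3 * card ?W"
  proof (rule G.card_arcs_bound_bipartite[where L = "pos ` V"])
    fix A x y assume "A \<in> AA" and A: "A \<inter> ?W = {x, y}"
    then obtain e v where ev: "A = half e v" "e \<in> crossed" "v \<in> e" using AAE[OF \<open>A \<in> AA\<close>] by blast
    then have "{x, y} = {pos v, cross_pt e}" using half_Int_vertices[OF ev(2,3)] A by simp
    moreover have "pos v \<in> pos ` V" using ev crossed_subset edge by blast
    moreover have "cross_pt e \<notin> pos ` V" using not_pos ev by blast
    ultimately show "x \<in> pos ` V \<longleftrightarrow> y \<notin> pos ` V" by (metis doubleton_eq_iff)
  next
    fix A B C D a b x y
    assume *: "A \<in> AA" "B \<in> AA" "C \<in> AA" "D \<in> AA" "A \<inter> ?W = {a, x}" "B \<inter> ?W = {a, y}"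
      "C \<inter> ?W = {b, x}" "D \<inter> ?W = {b, y}" "a \<in> pos ` V" "b \<in> pos ` V" "x \<notin> pos ` V" "y \<notin> pos ` V"
      "a \<noteq> b" "x \<noteq> y"
    obtain e1 v where 1: "e1 \<in> crossed" "v \<in> e1" "a = pos v" "x = cross_pt e1" using link[OF *(1,5,9,11)] by blast
    obtain e2 v' where 2: "e2 \<in> crossed" "v' \<in> e2" "a = pos v'" "y = cross_pt e2" using link[OF *(2,6,9,12)] by blast
    obtain e3 w where 3: "e3 \<in> crossed" "w \<in> e3" "b = pos w" "x = cross_pt e3" using link[OF *(3,7,10,11)] by blast
    obtain e4 w' where 4: "e4 \<in> crossed" "w' \<in> e4" "b = pos w'" "y = cross_pt e4" using link[OF *(4,8,10,12)] by blast
    have "x \<in> V" if "e \<in> crossed" "x \<in> e" for e x using that crossed_subset edge by blast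
    note V = this[OF 1(1,2)] this[OF 2(1,2)] this[OF 3(1,2)] this[OF 4(1,2)]
    have eq: "v = v'" "w = w'" "v \<noteq> w"
      using inj_onD[OF inj_pos, of v v'] inj_onD[OF inj_pos, of w w'] V 1(3) 2(3) 3(3) 4(3) *(13) by auto
    obtain f1 f2 where f: "cross e1 f1" "cross e2 f2" using 1(1) 2(1) unfolding crossed_def by blast
    \<comment> \<open>Edges through the crossing point \<open>x\<close> are \<open>e1\<close> and
      its partner \<open>f1\<close>; likewise \<open>e2\<close> and \<open>f2\<close> for
      \<open>y\<close>.\<close>
    have "e3 = e1 \<or> e3 = f1"
      using cross_pt_eqD[OF 1(1) 3(1)] 1(4) 3(4) cross_unique[OF f(1), of e3] by auto
    moreover have "e4 = e2 \<or> e4 = f2"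
      using cross_pt_eqD[OF 2(1) 4(1)] 2(4) 4(4) cross_unique[OF f(2), of e4] by auto
    \<comment> \<open>A 4-cycle through \<open>x\<close> and \<open>y\<close> puts two vertices into
      both neighbourhoods, against \<open>overlap\<close>.\<close>
    ultimately have sub: "{v, w} \<subseteq> \<Union>{e1, f1} \<inter> \<Union>{e2, f2}" using 1(2) 2(2) 3(2) 4(2) eq by auto
    have "{e1, f1} \<noteq> {e2, f2}"
      using 1(4) 2(4) *(14) cross_pt_eq[OF f(1)] cross_pt_eq[OF f(2)] by (metis doubleton_eq_iff)
    then have "card (\<Union>{e1, f1} \<inter> \<Union>{e2, f2}) \<le> 1"
      using overlap f unfolding crossing_pairs_def by blast
    moreover have "finite (\<Union>{e1, f1} \<inter> \<Union>{e2, f2})"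
      using fine[of e1] fine[of f1] 1(1) cross_sym[OF f(1)] unfolding crossed_def by blast
    ultimately show False using card_mono[OF _ sub] eq(3) by simp
  next
    show "4 \<le> card ?W"
      using card_mono[OF finV, of "pos ` V"] card_image[OF inj_pos] n unfolding bip_vertices_def by simp
  qed (fact simple)
  moreover have "card ?W \<le> card V + card crossing_pairs"
  proof -
    \<comment> \<open>Both edges of a pair have the same crossing point, so a pair contributes one
      false vertex. Thus 2(4c) + 6 <= 3(n + c).\<close>
    have "cross_pt ` crossed \<subseteq> (\<lambda>X. cross_pt (SOME e. e \<in> X)) ` crossing_pairs"
    proof (rule image_subsetI)
      fix e assume "e \<in> crossed"
      then obtain f where f: "cross e f" unfolding crossed_def by blast
      have "(SOME g. g \<in> {e, f}) \<in> {e, f}" by (rule someI[of _ e]) simp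
      then have "cross_pt e = cross_pt (SOME g. g \<in> {e, f})" using cross_pt_eq[OF f] by auto
      then show "cross_pt e \<in> (\<lambda>X. cross_pt (SOME e. e \<in> X)) ` crossing_pairs"
        using f unfolding crossing_pairs_def by blast
    qed
    then have "card (cross_pt ` crossed) \<le> card crossing_pairs"
      using finite_crossing_pairs by (meson card_image_le card_mono finite_imageI le_trans)
    then show ?thesis
      using card_Un_le[of "pos ` V" "cross_pt ` crossed"] card_image[OF inj_pos]
      unfolding bip_vertices_def by simp
  qed
  ultimately show ?thesis by simp
qed

end

section \<open>Transfer from \<open>real^2\<close> to \<open>complex\<close> and the upper
  bound\<close>

definition to_complex :: "real^2 \<Rightarrow> complex" where
  "to_complex v = Complex (v $ 1) (v $ 2)"

lemma inj_to_complex: "inj to_complex"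
  unfolding to_complex_def by (rule injI) (simp add: vec_eq_iff forall_2)

lemma continuous_on_to_complex: "continuous_on S to_complex"
proof -
  have "continuous_on S (\<lambda>v::real^2. complex_of_real (v $ 1) + \<i> * complex_of_real (v $ 2))"
    by (intro continuous_intros)
  then show ?thesis unfolding to_complex_def by (simp add: Complex_eq)
qed

lemma arc_to_complex: "arc g \<Longrightarrow> arc (to_complex \<circ> g)"
  using inj_to_complex continuous_on_to_complex unfolding arc_def path_def
  by (metis comp_inj_on continuous_on_compose inj_on_subset subset_UNIV)

text \<open>\<open>to_complex\<close> is continuous and injective: arcs stay arcs, and images
  commute with intersections, so the crossings are the same.\<close>

lemma drawing_to_complex:
  assumes G: "simple_graph V E" and D: "one_planar_drawing V E pos \<gamma>"
  shows "drawing V E (to_complex \<circ> pos) (\<lambda>e. to_complex \<circ> \<gamma> e)"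
    and "drawing.crossing_pairs E (\<lambda>e. to_complex \<circ> \<gamma> e) = crossings E \<gamma>"
proof -
  note D' = D[unfolded one_planar_drawing_def]
  note inj = D'[THEN conjunct1]
  note arcs = D'[THEN conjunct2, THEN conjunct1, rule_format]
  note adj = D'[THEN conjunct2, THEN conjunct2, THEN conjunct1, rule_format]
  note once = D'[THEN conjunct2, THEN conjunct2, THEN conjunct2, rule_format]
  have inner: "inner_curve (to_complex \<circ> \<gamma> e) = to_complex ` curve_interior (\<gamma> e)" for e
    unfolding curve_interior_def by (simp add: image_comp)
  have Int: "inner_curve (to_complex \<circ> \<gamma> e) \<inter> inner_curve (to_complex \<circ> \<gamma> f) = to_complex ` cross_points \<gamma> e f" for e f
    unfolding inner cross_points_def by (rule image_Int[OF inj_to_complex, symmetric])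
  show *: "drawing V E (to_complex \<circ> pos) (\<lambda>e. to_complex \<circ> \<gamma> e)"
  proof
    show "finite V" using G unfolding simple_graph_def by blast
    show "inj_on (to_complex \<circ> pos) V"
      using inj inj_to_complex by (meson comp_inj_on inj_on_subset subset_UNIV)
    fix e assume e: "e \<in> E"
    show "e \<subseteq> V \<and> card e = 2" using G e unfolding simple_graph_def by blast
    have De: "arc (\<gamma> e)" "\<exists>u v. e = {u, v} \<and> pathstart (\<gamma> e) = pos u \<and> pathfinish (\<gamma> e) = pos v"
      "curve_interior (\<gamma> e) \<inter> pos ` V = {}"
      using arcs[OF e] by auto
    show "arc (to_complex \<circ> \<gamma> e)" using De(1) by (rule arc_to_complex)
    show "{pathstart (to_complex \<circ> \<gamma> e), pathfinish (to_complex \<circ> \<gamma> e)} = (to_complex \<circ> pos) ` e"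
      using De(2) by (auto simp: pathstart_compose pathfinish_compose)
    show "inner_curve (to_complex \<circ> \<gamma> e) \<inter> (to_complex \<circ> pos) ` V = {}"
      using image_Int[OF inj_to_complex, of "curve_interior (\<gamma> e)" "pos ` V"] De(3)
      unfolding inner by (simp add: image_comp)
    show "inner_curve (to_complex \<circ> \<gamma> e) \<inter> inner_curve (to_complex \<circ> \<gamma> f) = {}"
      if "f \<in> E" "e \<noteq> f" "e \<inter> f \<noteq> {}" for f
      using adj[of e f] e that unfolding Int by auto
    obtain p g where "(\<Union>f\<in>E - {e}. cross_points \<gamma> e f) \<subseteq> {p}" "{f \<in> E - {e}. cross_points \<gamma> e f \<noteq> {}} \<subseteq> {g}"
      using once[OF e] by auto
    then show "\<exists>p. (\<Union>f\<in>E - {e}. inner_curve (to_complex \<circ> \<gamma> e) \<inter> inner_curve (to_complex \<circ> \<gamma> f)) \<subseteq> {p}"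
      "\<exists>g. {f \<in> E - {e}. inner_curve (to_complex \<circ> \<gamma> e) \<inter> inner_curve (to_complex \<circ> \<gamma> f) \<noteq> {}} \<subseteq> {g}"
      unfolding Int by (intro exI[of _ "to_complex p"] exI[of _ g]; blast)+
  qed
  show "drawing.crossing_pairs E (\<lambda>e. to_complex \<circ> \<gamma> e) = crossings E \<gamma>"
    unfolding drawing.crossing_pairs_def[OF *] drawing.cross_def[OF *] crossings_def Int by simp
qed

context drawing
begin

lemma card_Union_crossing:
  assumes "X \<in> crossing_pairs" shows "card (\<Union>X) = 4" "\<Union>X \<subseteq> V"
proof -
  obtain e f where ef: "X = {e, f}" "cross e f" using assms unfolding crossing_pairs_def by blast
  then have "e \<subseteq> V" "f \<subseteq> V" "card e = 2" "card f = 2" "e \<inter> f = {}"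
    using edge cross_disjoint unfolding cross_def by auto
  moreover from this have "finite e" "finite f" using finite_V finite_subset by auto
  ultimately show "card (\<Union>X) = 4" "\<Union>X \<subseteq> V"
    using ef card_Un_disjoint[of e f] by auto
qed

text \<open>Crossing edges have four distinct ends, and these quadruples are disjoint subsets of
  \<open>V\<close>.\<close>

lemma crossings_bound_disjoint:
  assumes "\<And>X Y. X \<in> crossing_pairs \<Longrightarrow> Y \<in> crossing_pairs \<Longrightarrow> X \<noteq> Y \<Longrightarrow> \<Union>X \<inter> \<Union>Y = {}"
  shows "4 * card crossing_pairs \<le> card V"
proof -
  have "finite (\<Union>X)" if "X \<in> crossing_pairs" for X
    by (rule finite_subset[OF card_Union_crossing(2)[OF that] finite_V])
  then have "card (\<Union>X\<in>crossing_pairs. \<Union>X) = (\<Sum>X\<in>crossing_pairs. card (\<Union>X))"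
    using finite_crossing_pairs assms by (intro card_UN_disjoint) simp_all
  also have "\<dots> = 4 * card crossing_pairs" using card_Union_crossing(1) by simp
  finally show ?thesis
    using card_mono[OF finite_V UN_least[of crossing_pairs Union V, OF card_Union_crossing(2)]] by simp
qed

end

theorem class_C1_card_edges:
  assumes "class_C1 V E"
  shows "real (card E) \<le> 3.6 * real (card V) - 7.2"
proof -
  have G: "simple_graph V E" using assms unfolding class_C1_def one_planar_def by blast
  have C1: "has_drawing_with_overlap V E 1" "\<not> has_drawing_with_overlap V E 0"
    using assms unfolding class_C1_def by blast+
  obtain pos \<gamma> where D: "one_planar_drawing V E pos \<gamma>"
    and overlap: "\<And>X Y. X \<in> crossings E \<gamma> \<Longrightarrow> Y \<in> crossings E \<gamma> \<Longrightarrow> X \<noteq> Y \<Longrightarrow> card (\<Union>X \<inter> \<Union>Y) \<le> 1"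
    using C1(1) unfolding has_drawing_with_overlap_def false_nbhd_def by blast
  interpret drawing V E "to_complex \<circ> pos" "\<lambda>e. to_complex \<circ> \<gamma> e"
    by (rule drawing_to_complex(1)[OF G D])
  note cp = drawing_to_complex(2)[OF G D]
  \<comment> \<open>Without crossings the drawing would satisfy the condition for overlap 0
    vacuously.\<close>
  have "crossings E \<gamma> \<noteq> {}"
    using C1(2) D unfolding has_drawing_with_overlap_def by (metis empty_iff)
  then obtain X where "X \<in> crossing_pairs" using cp by blast
  then have "4 \<le> card V" using card_Union_crossing[of X] card_mono[OF finite_V, of "\<Union>X"] by simp
  then have "5 * card crossing_pairs + 6 \<le> 3 * card V" "card E + 6 \<le> 3 * card V + card crossing_pairs"
    using crossings_bound edges_le_crossings overlap unfolding cp by simp_all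
  \<comment> \<open>With m edges, n vertices and c crossings: 5(m + 6) <= 15n + 5c <= 18n -
    6.\<close>
  then have "5 * card E + 36 \<le> 18 * card V" by linarith
  then have "5 * real (card E) + 36 \<le> 18 * real (card V)"
    by linarith
  then show ?thesis by simp
qed

text \<open>Combines m + 6 <= 3n + c with 4c <= n; this keeps the extremal graph out of class
  C_0.\<close>

lemma overlap_0_card_edges:
  assumes G: "simple_graph V E" and D: "has_drawing_with_overlap V E 0" and n: "3 \<le> card V"
  shows "4 * card E + 24 \<le> 13 * card V"
proof -
  obtain pos \<gamma> where D: "one_planar_drawing V E pos \<gamma>"
    and overlap: "\<And>X Y. X \<in> crossings E \<gamma> \<Longrightarrow> Y \<in> crossings E \<gamma> \<Longrightarrow> X \<noteq> Y \<Longrightarrow> card (\<Union>X \<inter> \<Union>Y) \<le> 0"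
    using D unfolding has_drawing_with_overlap_def false_nbhd_def by blast
  interpret drawing V E "to_complex \<circ> pos" "\<lambda>e. to_complex \<circ> \<gamma> e"
    by (rule drawing_to_complex(1)[OF G D])
  note cp = drawing_to_complex(2)[OF G D]
  have "\<Union>X \<inter> \<Union>Y = {}" if "X \<in> crossing_pairs" "Y \<in> crossing_pairs" "X \<noteq> Y" for X Y
    using overlap[of X Y] that cp card_Union_crossing(2)[of X] finite_V
    by (metis card_0_eq finite_Int finite_subset le_zero_eq)
  then have "4 * card crossing_pairs \<le> card V" by (rule crossings_bound_disjoint)
  then show ?thesis using edges_le_crossings[OF n] by linarith
qed

section \<open>The extremal graph\<close>

text \<open>Twice the signed area of the triangle \<open>p\<close>, \<open>q\<close>,
  \<open>r\<close>: its sign tells on which side of the line \<open>p q\<close> the point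
  \<open>r\<close> lies.\<close>

definition orient :: "real^2 \<Rightarrow> real^2 \<Rightarrow> real^2 \<Rightarrow> real" where
  "orient p q r = (q $ 1 - p $ 1) * (r $ 2 - p $ 2) - (q $ 2 - p $ 2) * (r $ 1 - p $ 1)"

lemma orient_linepath: "orient p q (linepath r s t) = (1 - t) * orient p q r + t * orient p q s"
  unfolding orient_def linepath_def by (simp add: algebra_simps)

lemma orient_self: "orient p q p = 0" "orient p q q = 0"
  unfolding orient_def by auto

lemma in_curve_interior_linepath:
  "x \<in> curve_interior (linepath p q) \<Longrightarrow> \<exists>t. 0 < t \<and> t < 1 \<and> x = linepath p q t"
  unfolding curve_interior_def by auto

lemma orient_curve_interior: "x \<in> curve_interior (linepath p q) \<Longrightarrow> orient p q x = 0"
  using in_curve_interior_linepath[of x p q] by (auto simp: orient_linepath orient_self)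

text \<open>The inner points of \<open>r s\<close> lie strictly on one side of the line
  \<open>p q\<close>. One end may lie on that line, so edges with a common end are covered.\<close>

lemma segments_disjoint:
  assumes "orient p q r \<ge> 0 \<and> orient p q s \<ge> 0 \<or> orient p q r \<le> 0 \<and> orient p q s \<le> 0"
    and "orient p q r \<noteq> 0 \<or> orient p q s \<noteq> 0"
  shows "curve_interior (linepath p q) \<inter> curve_interior (linepath r s) = {}"
proof (rule ccontr)
  assume "\<not> ?thesis"
  then obtain x where x: "x \<in> curve_interior (linepath p q)" "x \<in> curve_interior (linepath r s)" by blast
  obtain t where t: "0 < t" "t < 1" "x = linepath r s t" using in_curve_interior_linepath[OF x(2)] by blast
  then have z: "(1 - t) * orient p q r + t * orient p q s = 0"
    using orient_curve_interior[OF x(1)] by (simp add: orient_linepath)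
  from assms(1) show False
  proof
    assume *: "orient p q r \<ge> 0 \<and> orient p q s \<ge> 0"
    then have "(1 - t) * orient p q r \<ge> 0" "t * orient p q s \<ge> 0" using t by auto
    then have "(1 - t) * orient p q r = 0" "t * orient p q s = 0" using z by linarith+
    then show False using t assms(2) by auto
  next
    assume *: "orient p q r \<le> 0 \<and> orient p q s \<le> 0"
    then have "(1 - t) * orient p q r \<le> 0" "t * orient p q s \<le> 0"
      using t by (auto simp: mult_nonneg_nonpos)
    then have "(1 - t) * orient p q r = 0" "t * orient p q s = 0" using z by linarith+
    then show False using t assms(2) by auto
  qed
qed

text \<open>Along \<open>r s\<close> the value of \<open>orient p q\<close> is affine and not
  constant; \<open>t\<close> is its only zero.\<close>

lemma segments_Int_singleton:
  assumes "orient p q r \<noteq> orient p q s"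
  shows "\<exists>y. curve_interior (linepath p q) \<inter> curve_interior (linepath r s) \<subseteq> {y}"
proof -
  define t where "t = orient p q r / (orient p q r - orient p q s)"
  have "x = linepath r s t" if x: "x \<in> curve_interior (linepath p q)" "x \<in> curve_interior (linepath r s)" for x
  proof -
    obtain u where u: "x = linepath r s u" using in_curve_interior_linepath[OF x(2)] by blast
    then have "(1 - u) * orient p q r + u * orient p q s = 0"
      using orient_curve_interior[OF x(1)] by (simp add: orient_linepath)
    then have "u * (orient p q r - orient p q s) = orient p q r" by (simp add: algebra_simps)
    then have "u = t" unfolding t_def using assms by (simp add: eq_divide_eq)
    then show ?thesis using u by simp
  qed
  then show ?thesis by blast
qed

text \<open>The cuboctahedron, drawn with one of its triangles as the outer face, together with both
  diagonals of each of its six quadrangular faces.\<close>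

definition cub_edges :: "(nat \<times> nat) list" where
  "cub_edges = [(0,1), (0,2), (0,3), (0,4), (0,5), (0,8), (1,2), (1,4), (1,5), (1,6), (1,7),
    (2,3), (2,6), (2,7), (2,8), (3,4), (3,8), (3,9), (3,11), (4,5), (4,9), (4,11), (5,6), (5,9),
    (5,10), (6,7), (6,9), (6,10), (7,8), (7,10), (7,11), (8,10), (8,11), (9,10), (9,11), (10,11)]"

definition cub_diagonals :: "((nat \<times> nat) \<times> (nat \<times> nat)) list" where
  "cub_diagonals = [((0,5),(1,4)), ((6,9),(5,10)), ((1,7),(2,6)), ((8,10),(7,11)), ((2,3),(0,8)),
    ((4,11),(3,9))]"

text \<open>The other diagonal of the same face; edges of the cuboctahedron itself are fixed.\<close>

definition cub_mate :: "nat \<times> nat \<Rightarrow> nat \<times> nat" where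
  "cub_mate e = (case map_of (cub_diagonals @ map prod.swap cub_diagonals) e of Some f \<Rightarrow> f | None \<Rightarrow> e)"

text \<open>Vertices 0 to 2 form the outer triangle, 3 to 8 a hexagon and 9 to 11 the inner
  triangle. The coordinates make all six quadrangles convex, and being integers they allow
  evaluation.\<close>

definition cub_x :: "nat \<Rightarrow> int" where
  "cub_x i = [7, 0, -7, 2, 4, 2, -2, -4, -2, 1, -1, 0] ! i"

definition cub_y :: "nat \<Rightarrow> int" where
  "cub_y i = [0, 7, -7, -2, 2, 4, 2, -2, -4, 1, 0, -1] ! i"

definition cub_orient :: "nat \<times> nat \<Rightarrow> nat \<Rightarrow> int" where
  "cub_orient e k = (case e of (i, j) \<Rightarrow>
     (cub_x j - cub_x i) * (cub_y k - cub_y i) - (cub_y j - cub_y i) * (cub_x k - cub_x i))"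

text \<open>The hypothesis of \<open>segments_disjoint\<close> in computable integer form.\<close>

definition cub_separated :: "nat \<times> nat \<Rightarrow> nat \<times> nat \<Rightarrow> bool" where
  "cub_separated e f \<longleftrightarrow> (let r = cub_orient e (fst f); s = cub_orient e (snd f) in
     (r \<ge> 0 \<and> s \<ge> 0 \<or> r \<le> 0 \<and> s \<le> 0) \<and> (r \<noteq> 0 \<or> s \<noteq> 0))"

definition cub_ends :: "nat \<times> nat \<Rightarrow> nat list" where
  "cub_ends e = [fst e, snd e, fst (cub_mate e), snd (cub_mate e)]"

section \<open>Checks by evaluation\<close>

lemma cub_edges_wf: "list_all (\<lambda>(i, j). i < j \<and> j < 12) cub_edges"
  by code_simp

lemma cub_edges_distinct: "distinct cub_edges"
  by code_simp

lemma cub_vertices_distinct: "distinct (map (\<lambda>i. (cub_x i, cub_y i)) [0..<12])"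
  by code_simp

lemma cub_general_position:
  "list_all (\<lambda>e. list_all (\<lambda>k. k = fst e \<or> k = snd e \<or> cub_orient e k \<noteq> 0) [0..<12]) cub_edges"
  by code_simp

text \<open>The test is not symmetric: the separating line may be the one through either
  edge.\<close>

lemma cub_noncrossing:
  "list_all (\<lambda>e. list_all (\<lambda>f. f = e \<or> f = cub_mate e \<or> cub_separated e f \<or> cub_separated f e) cub_edges) cub_edges"
  by code_simp

lemma cub_mate_crossing:
  "list_all (\<lambda>e. cub_mate e = e \<or> (let f = cub_mate e in cub_orient e (fst f) \<noteq> cub_orient e (snd f)
     \<and> fst e \<noteq> fst f \<and> fst e \<noteq> snd f \<and> snd e \<noteq> fst f \<and> snd e \<noteq> snd f)) cub_edges"
  by code_simp

text \<open>For a diagonal, \<open>cub_ends\<close> lists the four corners of its face, and distinct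
  quadrangles share at most one corner.\<close>

lemma cub_overlap:
  "list_all (\<lambda>e. list_all (\<lambda>f. cub_mate e = e \<or> cub_mate f = f \<or> f = e \<or> f = cub_mate e \<or>
     length (filter (\<lambda>k. k \<in> set (cub_ends f)) (cub_ends e)) \<le> 1) cub_edges) cub_edges"
  by code_simp

lemma cub_mate_mate: "list_all (\<lambda>e. cub_mate (cub_mate e) = e) cub_edges"
  by code_simp

section \<open>The straight-line drawing and its class\<close>

definition cub_pos :: "nat \<Rightarrow> real^2" where
  "cub_pos i = vector [of_int (cub_x i), of_int (cub_y i)]"

text \<open>Edges are sets here; \<open>Min\<close> and \<open>Max\<close> recover the pair, as all
  pairs in \<open>cub_edges\<close> are increasing.\<close>

definition cub_curve :: "nat set \<Rightarrow> real \<Rightarrow> real^2" where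
  "cub_curve X = linepath (cub_pos (Min X)) (cub_pos (Max X))"

definition pair_set :: "nat \<times> nat \<Rightarrow> nat set" where
  "pair_set e = {fst e, snd e}"

definition cub_graph :: "nat set set" where
  "cub_graph = pair_set ` set cub_edges"

lemma cub_edge:
  assumes "e \<in> set cub_edges" shows "fst e < snd e" "snd e < 12"
  using assms cub_edges_wf by (auto simp: list_all_iff)

lemma cub_curve_pair: "e \<in> set cub_edges \<Longrightarrow> cub_curve (pair_set e) = linepath (cub_pos (fst e)) (cub_pos (snd e))"
  unfolding cub_curve_def pair_set_def by (auto dest!: cub_edge(1) simp: min_def max_def)

lemma pair_set_inj: "e \<in> set cub_edges \<Longrightarrow> f \<in> set cub_edges \<Longrightarrow> pair_set e = pair_set f \<Longrightarrow> e = f"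
  unfolding pair_set_def using cub_edge(1)[of e] cub_edge(1)[of f]
  by (auto simp: doubleton_eq_iff prod_eq_iff)

lemma cub_orient: "orient (cub_pos (fst e)) (cub_pos (snd e)) (cub_pos k) = of_int (cub_orient e k)"
  unfolding orient_def cub_pos_def cub_orient_def by (simp add: case_prod_beta)

lemma inj_cub_pos: "inj_on cub_pos {..<12}"
proof (rule inj_onI)
  fix i j :: nat assume ij: "i \<in> {..<12}" "j \<in> {..<12}" "cub_pos i = cub_pos j"
  then have "cub_pos i $ 1 = cub_pos j $ 1" "cub_pos i $ 2 = cub_pos j $ 2" by auto
  then have "(cub_x i, cub_y i) = (cub_x j, cub_y j)" unfolding cub_pos_def by simp
  moreover have "inj_on (\<lambda>i. (cub_x i, cub_y i)) (set [0..<12])"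
    using cub_vertices_distinct unfolding distinct_map by blast
  ultimately show "i = j" using ij by (auto dest!: inj_onD)
qed

lemma cub_cross_points:
  assumes "e \<in> set cub_edges" "f \<in> set cub_edges" "f \<noteq> e" "f \<noteq> cub_mate e"
  shows "cross_points cub_curve (pair_set e) (pair_set f) = {}"
proof -
  have "cub_separated e f \<or> cub_separated f e"
    using cub_noncrossing assms unfolding list_all_iff by blast
  then show ?thesis
  proof
    assume "cub_separated e f"
    then show ?thesis
      using segments_disjoint[of "cub_pos (fst e)" "cub_pos (snd e)" "cub_pos (fst f)" "cub_pos (snd f)"]
      unfolding cross_points_def cub_curve_pair[OF assms(1)] cub_curve_pair[OF assms(2)]
        cub_orient cub_separated_def Let_def by simp
  next
    assume "cub_separated f e"
    then show ?thesis
      using segments_disjoint[of "cub_pos (fst f)" "cub_pos (snd f)" "cub_pos (fst e)" "cub_pos (snd e)"]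
      unfolding cross_points_def cub_curve_pair[OF assms(1)] cub_curve_pair[OF assms(2)]
        cub_orient cub_separated_def Let_def by auto
  qed
qed

lemma cub_one_planar_drawing: "one_planar_drawing {..<12} cub_graph cub_pos cub_curve"
  unfolding one_planar_drawing_def
proof (intro conjI ballI impI)
  show "inj_on cub_pos {..<12}" by (rule inj_cub_pos)
  fix X assume "X \<in> cub_graph"
  then obtain e where e: "e \<in> set cub_edges" "X = pair_set e" unfolding cub_graph_def by blast
  have ne: "cub_pos (fst e) \<noteq> cub_pos (snd e)"
    using cub_edge[OF e(1)] inj_onD[OF inj_cub_pos, of "fst e" "snd e"] by auto
  show "arc (cub_curve X)" using ne e cub_curve_pair by simp
  show "\<exists>u v. X = {u, v} \<and> pathstart (cub_curve X) = cub_pos u \<and> pathfinish (cub_curve X) = cub_pos v"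
    using e cub_curve_pair[OF e(1)] unfolding pair_set_def by (intro exI[of _ "fst e"] exI[of _ "snd e"]) simp
  have "x \<notin> curve_interior (linepath (cub_pos (fst e)) (cub_pos (snd e)))" if xV: "x \<in> cub_pos ` {..<12}" for x
  proof
    assume x: "x \<in> curve_interior (linepath (cub_pos (fst e)) (cub_pos (snd e)))"
    obtain k where k: "k < 12" "x = cub_pos k" using xV by auto
    have "cub_orient e k = 0" using orient_curve_interior[OF x] k cub_orient by simp
    then have "k = fst e \<or> k = snd e"
      using cub_general_position e(1) k(1) unfolding list_all_iff by fastforce
    then have "x = cub_pos (fst e) \<or> x = cub_pos (snd e)" using k by blast
    \<comment> \<open>A segment is injective, so an end of it cannot be an inner point.\<close>
    moreover obtain t where "0 < t" "t < 1" "x = linepath (cub_pos (fst e)) (cub_pos (snd e)) t"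
      using in_curve_interior_linepath[OF x] by blast
    ultimately show False
      using ne arc_linepath[OF ne] unfolding arc_def
      by (metis (no_types, opaque_lifting) atLeastAtMost_iff inj_onD less_eq_real_def less_irrefl
          linepath_0' linepath_1' order_refl zero_le_one)
  qed
  then show "curve_interior (cub_curve X) \<inter> cub_pos ` {..<12} = {}"
    using e cub_curve_pair by auto
  have mate: "Z = pair_set (cub_mate e) \<and> cub_mate e \<in> set cub_edges \<and> cub_mate e \<noteq> e"
    if Z: "Z \<in> cub_graph" "Z \<noteq> X" "cross_points cub_curve X Z \<noteq> {}" for Z
  proof -
    obtain f where f: "f \<in> set cub_edges" "Z = pair_set f" using Z(1) unfolding cub_graph_def by blast
    then have "f \<noteq> e" using Z(2) e(2) by blast
    then have "f = cub_mate e" using cub_cross_points[OF e(1) f(1)] Z(3) e(2) f(2) by blast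
    then show ?thesis using f \<open>f \<noteq> e\<close> by blast
  qed
  show "\<exists>Y. {Z \<in> cub_graph - {X}. cross_points cub_curve X Z \<noteq> {}} \<subseteq> {Y}"
    using mate by (intro exI[of _ "pair_set (cub_mate e)"]) blast
  show "\<exists>p. (\<Union>Z\<in>cub_graph - {X}. cross_points cub_curve X Z) \<subseteq> {p}"
  \<comment> \<open>A diagonal can meet only its mate, on a line not parallel to it; any other edge
    is its own mate and is crossed by nothing.\<close>
  proof (cases "cub_mate e \<in> set cub_edges \<and> cub_mate e \<noteq> e")
    case True
    then have "cub_orient e (fst (cub_mate e)) \<noteq> cub_orient e (snd (cub_mate e))"
      using cub_mate_crossing e(1) unfolding list_all_iff Let_def by blast
    then obtain p where "cross_points cub_curve X (pair_set (cub_mate e)) \<subseteq> {p}"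
      using segments_Int_singleton[of "cub_pos (fst e)" "cub_pos (snd e)"
          "cub_pos (fst (cub_mate e))" "cub_pos (snd (cub_mate e))"] True e
      unfolding cross_points_def by (auto simp: cub_curve_pair cub_orient)
    then show ?thesis using mate by (intro exI[of _ p]) blast
  next
    case False
    then have "cross_points cub_curve X Z = {}" if "Z \<in> cub_graph - {X}" for Z
      using that mate by blast
    then show ?thesis by blast
  qed
  fix Y assume Y: "Y \<in> cub_graph" and XY: "X \<noteq> Y \<and> X \<inter> Y \<noteq> {}"
  show "cross_points cub_curve X Y = {}"
  proof (rule ccontr)
    assume "\<not> ?thesis"
    then have f: "Y = pair_set (cub_mate e)" "cub_mate e \<noteq> e" using mate[OF Y] XY by auto
    moreover have "fst e \<noteq> fst (cub_mate e) \<and> fst e \<noteq> snd (cub_mate e) \<and>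
        snd e \<noteq> fst (cub_mate e) \<and> snd e \<noteq> snd (cub_mate e)"
      using cub_mate_crossing e(1) f(2) unfolding list_all_iff Let_def by blast
    ultimately have "X \<inter> Y = {}" using e(2) unfolding pair_set_def by auto
    then show False using XY by blast
  qed
qed

lemma cub_has_drawing_with_overlap: "has_drawing_with_overlap {..<12} cub_graph 1"
proof -
  have cr: "\<exists>e\<in>set cub_edges. X = {pair_set e, pair_set (cub_mate e)} \<and> cub_mate e \<in> set cub_edges \<and> cub_mate e \<noteq> e"
    if X: "X \<in> crossings cub_graph cub_curve" for X
  proof -
    obtain e f where ef: "e \<in> set cub_edges" "f \<in> set cub_edges" "X = {pair_set e, pair_set f}" "pair_set e \<noteq> pair_set f"
      "cross_points cub_curve (pair_set e) (pair_set f) \<noteq> {}"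
      using X unfolding crossings_def cub_graph_def by blast
    then have "f = cub_mate e" using cub_cross_points[of e f] by blast
    then show ?thesis using ef by auto
  qed
  have nbhd: "false_nbhd {pair_set e, pair_set (cub_mate e)} = set (cub_ends e)" for e
    unfolding false_nbhd_def pair_set_def cub_ends_def by auto
  have "card (false_nbhd X \<inter> false_nbhd Y) \<le> 1"
    if XY: "X \<in> crossings cub_graph cub_curve" "Y \<in> crossings cub_graph cub_curve" "X \<noteq> Y" for X Y
  proof -
    obtain e where e: "e \<in> set cub_edges" "X = {pair_set e, pair_set (cub_mate e)}" "cub_mate e \<noteq> e"
      using cr[OF XY(1)] by blast
    obtain f where f: "f \<in> set cub_edges" "Y = {pair_set f, pair_set (cub_mate f)}" "cub_mate f \<noteq> f"
      using cr[OF XY(2)] by blast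
    have "cub_mate (cub_mate e) = e" using cub_mate_mate e(1) unfolding list_all_iff by blast
    then have "f \<noteq> e" "f \<noteq> cub_mate e" using XY(3) e(2) f(2) by auto
    then have "length (filter (\<lambda>k. k \<in> set (cub_ends f)) (cub_ends e)) \<le> 1"
      using cub_overlap e f unfolding list_all_iff by blast
    moreover have "false_nbhd X \<inter> false_nbhd Y = set (filter (\<lambda>k. k \<in> set (cub_ends f)) (cub_ends e))"
      using e(2) f(2) nbhd by auto
    ultimately show ?thesis using card_length le_trans by metis
  qed
  then show ?thesis
    unfolding has_drawing_with_overlap_def using cub_one_planar_drawing by blast
qed

lemma card_cub_graph: "card cub_graph = 36"
proof -
  have "card cub_graph = card (set cub_edges)"
    unfolding cub_graph_def by (rule card_image) (meson inj_onI pair_set_inj)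
  also have "\<dots> = length cub_edges" using cub_edges_distinct by (rule distinct_card)
  finally show ?thesis by (simp add: cub_edges_def)
qed

lemma cub_class_C1: "class_C1 {..<12} cub_graph"
proof -
  have G: "simple_graph {..<12} cub_graph"
    unfolding simple_graph_def cub_graph_def pair_set_def
    by (auto dest: cub_edge simp: card_2_iff) (use cub_edge in fastforce)+
  \<comment> \<open>Overlap 0 would require 4 * 36 + 24 = 168 <= 156 = 13 * 12.\<close>
  have "\<not> has_drawing_with_overlap {..<12} cub_graph 0"
    using overlap_0_card_edges[OF G] card_cub_graph by auto
  then show ?thesis
    unfolding class_C1_def one_planar_def
    using G cub_one_planar_drawing cub_has_drawing_with_overlap by blast
qed

theorem theorem20:
  shows "(\<forall>(V :: 'a set) (E :: 'a set set). class_C1 V E \<longrightarrow>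
            real (card E) \<le> 3.6 * real (card V) - 7.2) \<and>
         (\<exists>(V :: nat set) (E :: nat set set). class_C1 V E \<and>
            real (card E) = 3.6 * real (card V) - 7.2)"
proof (intro conjI allI impI)
  show "real (card E) \<le> 3.6 * real (card V) - 7.2" if "class_C1 V E" for V :: "'a set" and E
    using that by (rule class_C1_card_edges)
  show "\<exists>(V :: nat set) E. class_C1 V E \<and> real (card E) = 3.6 * real (card V) - 7.2"
    \<comment> \<open>3.6 * 12 - 7.2 = 36.\<close>
    using cub_class_C1 card_cub_graph by (intro exI[of _ "{..<12}"] exI[of _ cub_graph]) simp
qed

end
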